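(* Let $X_1,\dots,X_n$ be the Hall–Grayson–Grossman vector fields on $\mathbb{R}^n$ (realizing the free nilpotent Lie group $G=\mathbb{R}^n$ of rank $r\ge2$ and step $s\ge2$) with structure constants $c_{ij}^k$, let $\gamma:[0,1]\to\mathbb{R}^n$ be a horizontal curve with $\gamma(0)=0$, and let $\lambda:[0,1]\to\mathbb{R}^n$ be a Lipschitz curve. The following are equivalent: (A) for every $i=1,\dots,n$, $\dot\lambda_i=-\sum_{k=1}^n\sum_{j=1}^rc_{ij}^k\dot\gamma_j\lambda_k$ a.e. on $[0,1]$; (B) there exists $v\in\mathbb{R}^n$ such that $\lambda_i(t)=P^v_i(\gamma(t))$ for all $t\in[0,1]$ and all $i=1,\dots,n$; and in fact $v=\lambda(0)$.
   Context: Multi-indices: $\mathcal I=\mathbb{N}^n$; $|\alpha|=\sum\alpha_i$, $\alpha!=\prod\alpha_i!$, $x^\alpha=\prod x_i^{\alpha_i}$. Hall basis. Let $\mathfrak g=\mathfrak g_1\oplus\cdots\oplus\mathfrak g_s$ be the free nilpotent real Lie algebra of rank $r$ and step $s$, dimension $n$. Take a basis $X_1,\dots,X_r$ of $\mathfrak g_1$ (degree 1). Inductively, the basis elements of degree $d$ are the brackets $[X_i,X_j]$ of previously constructed elements with $i>j$, $d(i)+d(j)=d$, and such that, if $X_i$ was constructed as $[X_h,X_k]$, then $k\le j$; they are appended after those of lower degree. This gives a basis $X_1,\dots,X_n$. To each index $\ell$ attach a string: $(\ell)$ if $\ell\le r$; if $X_\ell=[X_a,X_b]$ was so constructed, the string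 of $a$ followed by $b$. With string $(\ell_0,\dots,\ell_h)$ one has $X_\ell=[\cdots[X_{\ell_0},X_{\ell_1}],\dots,X_{\ell_h}]$; set $I(\ell)_j=\#\{1\le p\le h:\ell_p=j\}$; write $j\prec\ell$ if the string of $j$ is an initial segment of that of $\ell$. For $\alpha\in\mathcal I$, $[Y,X_\alpha]$ is the left-nested bracket of $Y$ successively with $X_1$ ($\alpha_1$ times), $X_2$ ($\alpha_2$ times), ..., $X_n$ ($\alpha_n$ times); $[Y,X_0]=Y$. Realization: on $\mathbb{R}^n$ set $X_i=\sum_{\ell:\,i\prec\ell}\frac{(-1)^{|I(\ell)|}}{I(\ell)!}x^{I(\ell)}\partial_{x_\ell}$ for $i\le r$, and $X_\ell=[X_a,X_b]$ (vector field bracket) for $\ell>r$ constructed as $[X_a,X_b]$. These form a frame and a basis of a Lie algebra isomorphic to $\mathfrak g$; $[X_i,X_j]=\sum_kc_{ij}^kX_k$ with constants $c^k_{ij}$. Generalized structure constants: $[X_i,X_\alpha]=\sum_kc^k_{i\alpha}X_k$. Extremal polynomials: $P^v_i(x)=\sum_{\alpha\in\mathcal I}\frac{(-1)^{|\alpha|}}{\alpha!}\big(\sum_{k=1}^nc^k_{i\alpha}v_k\big)x^\alpha$ for $v\in\mathbb{R}^n$. A Lipschitz $\gamma:[0,1]\to\mathbb{R}^n$ is horizontal if $\dot\gamma=\sum_{j=1}^rh_jX_j(\gamma)$ a.e. for some $h\in L^\infty([0,1];\mathbb{R}^r)$; here $h_j=\dot\gamma_j$. *)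

theory Defs
  imports "HOL-Analysis.Analysis" "HOL-Library.Sublist"
begin

text \<open>Points of R^n are functions nat => real, only coordinates 1..n matter.
  Vector fields are maps (nat => real) => (nat => real).
  A Hall basis is encoded by: its dimension n, the map K sending an index l > r
  to the pair (a,b) with X_l = [X_a, X_b], and the degree function dg.\<close>

type_synonym vfield = "(nat \<Rightarrow> real) \<Rightarrow> (nat \<Rightarrow> real)"

definition hall_basis :: "nat \<Rightarrow> nat \<Rightarrow> nat \<Rightarrow> (nat \<Rightarrow> nat \<times> nat) \<Rightarrow> (nat \<Rightarrow> nat) \<Rightarrow> bool" where
  "hall_basis r s n K dg \<longleftrightarrow>
     r \<le> n \<and>
     (\<forall>l\<in>{1..r}. dg l = 1) \<and>
     (\<forall>l\<in>{r+1..n}. 1 \<le> snd (K l) \<and> snd (K l) < fst (K l) \<and> fst (K l) < l \<and>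
        dg l = dg (fst (K l)) + dg (snd (K l)) \<and>
        (r < fst (K l) \<longrightarrow> snd (K (fst (K l))) \<le> snd (K l))) \<and>
     (\<forall>l\<in>{1..n}. \<forall>m\<in>{1..n}. l \<le> m \<longrightarrow> dg l \<le> dg m) \<and>
     (\<forall>l\<in>{1..n}. dg l \<le> s) \<and>
     inj_on K {r+1..n} \<and>
     (\<forall>a\<in>{1..n}. \<forall>b\<in>{1..n}. b < a \<and> dg a + dg b \<le> s \<and> (r < a \<longrightarrow> snd (K a) \<le> b)
        \<longrightarrow> (\<exists>l\<in>{r+1..n}. K l = (a, b)))"

function hstr :: "nat \<Rightarrow> (nat \<Rightarrow> nat \<times> nat) \<Rightarrow> nat \<Rightarrow> nat list" where
  "hstr r K l = (if r < l \<and> fst (K l) < l then hstr r K (fst (K l)) @ [snd (K l)] else [l])"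
  by pat_completeness auto
termination by (relation "Wellfounded.measure (\<lambda>(r, K, l). l)") auto

declare hstr.simps[simp del]

definition Iidx :: "nat \<Rightarrow> (nat \<Rightarrow> nat \<times> nat) \<Rightarrow> nat \<Rightarrow> nat \<Rightarrow> nat" where
  "Iidx r K l j = count_list (tl (hstr r K l)) j"

definition midx :: "nat \<Rightarrow> (nat \<Rightarrow> nat) set" where
  "midx n = {\<alpha>. \<forall>j. j \<notin> {1..n} \<longrightarrow> \<alpha> j = 0}"

definition mabs :: "nat \<Rightarrow> (nat \<Rightarrow> nat) \<Rightarrow> nat" where
  "mabs n \<alpha> = (\<Sum>j=1..n. \<alpha> j)"

definition mfact :: "nat \<Rightarrow> (nat \<Rightarrow> nat) \<Rightarrow> real" where
  "mfact n \<alpha> = (\<Prod>j=1..n. fact (\<alpha> j))"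

definition mpow :: "nat \<Rightarrow> (nat \<Rightarrow> real) \<Rightarrow> (nat \<Rightarrow> nat) \<Rightarrow> real" where
  "mpow n x \<alpha> = (\<Prod>j=1..n. x j ^ \<alpha> j)"

definition pd :: "((nat \<Rightarrow> real) \<Rightarrow> real) \<Rightarrow> nat \<Rightarrow> (nat \<Rightarrow> real) \<Rightarrow> real" where
  "pd f k x = deriv (\<lambda>t. f (x(k := t))) (x k)"

definition vf_bracket :: "nat \<Rightarrow> vfield \<Rightarrow> vfield \<Rightarrow> vfield" where
  "vf_bracket n V W = (\<lambda>x l. \<Sum>k=1..n. V x k * pd (\<lambda>y. W y l) k x - W x k * pd (\<lambda>y. V y l) k x)"

definition genvf :: "nat \<Rightarrow> nat \<Rightarrow> (nat \<Rightarrow> nat \<times> nat) \<Rightarrow> nat \<Rightarrow> vfield" where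
  "genvf r n K i = (\<lambda>x l. if l \<in> {1..n} \<and> prefix (hstr r K i) (hstr r K l)
      then (-1) ^ mabs n (Iidx r K l) / mfact n (Iidx r K l) * mpow n x (Iidx r K l)
      else 0)"

function hvf :: "nat \<Rightarrow> nat \<Rightarrow> (nat \<Rightarrow> nat \<times> nat) \<Rightarrow> nat \<Rightarrow> vfield" where
  "hvf r n K l = (if r < l \<and> fst (K l) < l \<and> snd (K l) < l
     then vf_bracket n (hvf r n K (fst (K l))) (hvf r n K (snd (K l)))
     else genvf r n K l)"
  by pat_completeness auto
termination by (relation "Wellfounded.measure (\<lambda>(r, n, K, l). l)") auto

declare hvf.simps[simp del]

definition sc :: "nat \<Rightarrow> nat \<Rightarrow> (nat \<Rightarrow> nat \<times> nat) \<Rightarrow> nat \<Rightarrow> nat \<Rightarrow> nat \<Rightarrow> real" where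
  "sc r n K i j = (THE c. (\<forall>k. k \<notin> {1..n} \<longrightarrow> c k = 0) \<and>
     (\<forall>x. \<forall>l\<in>{1..n}. vf_bracket n (hvf r n K i) (hvf r n K j) x l
          = (\<Sum>k=1..n. c k * hvf r n K k x l)))"

definition alist :: "nat \<Rightarrow> (nat \<Rightarrow> nat) \<Rightarrow> nat list" where
  "alist n \<alpha> = concat (map (\<lambda>j. replicate (\<alpha> j) j) [1..<Suc n])"

definition gbr :: "nat \<Rightarrow> nat \<Rightarrow> (nat \<Rightarrow> nat \<times> nat) \<Rightarrow> nat \<Rightarrow> (nat \<Rightarrow> nat) \<Rightarrow> vfield" where
  "gbr r n K i \<alpha> = foldl (\<lambda>V j. vf_bracket n V (hvf r n K j)) (hvf r n K i) (alist n \<alpha>)"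

definition gsc :: "nat \<Rightarrow> nat \<Rightarrow> (nat \<Rightarrow> nat \<times> nat) \<Rightarrow> nat \<Rightarrow> (nat \<Rightarrow> nat) \<Rightarrow> nat \<Rightarrow> real" where
  "gsc r n K i \<alpha> = (THE c. (\<forall>k. k \<notin> {1..n} \<longrightarrow> c k = 0) \<and>
     (\<forall>x. \<forall>l\<in>{1..n}. gbr r n K i \<alpha> x l = (\<Sum>k=1..n. c k * hvf r n K k x l)))"

definition Pext :: "nat \<Rightarrow> nat \<Rightarrow> (nat \<Rightarrow> nat \<times> nat) \<Rightarrow> (nat \<Rightarrow> real) \<Rightarrow> nat \<Rightarrow> (nat \<Rightarrow> real) \<Rightarrow> real" where
  "Pext r n K v i x = infsum (\<lambda>\<alpha>. (-1) ^ mabs n \<alpha> / mfact n \<alpha> *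
       (\<Sum>k=1..n. gsc r n K i \<alpha> k * v k) * mpow n x \<alpha>) (midx n)"

definition lipcurve :: "nat \<Rightarrow> (real \<Rightarrow> nat \<Rightarrow> real) \<Rightarrow> bool" where
  "lipcurve n \<gamma> \<longleftrightarrow> (\<exists>L. \<forall>s\<in>{0..1}. \<forall>t\<in>{0..1}. \<forall>k\<in>{1..n}. \<bar>\<gamma> s k - \<gamma> t k\<bar> \<le> L * \<bar>s - t\<bar>)"

definition horizontal :: "nat \<Rightarrow> nat \<Rightarrow> (nat \<Rightarrow> nat \<times> nat) \<Rightarrow> (real \<Rightarrow> nat \<Rightarrow> real) \<Rightarrow> bool" where
  "horizontal r n K \<gamma> \<longleftrightarrow> lipcurve n \<gamma> \<and>
     (\<exists>h :: nat \<Rightarrow> real \<Rightarrow> real.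
        (\<forall>j\<in>{1..r}. h j \<in> borel_measurable (restrict_space lborel {0..1}) \<and>
           (\<exists>B. AE t in lborel. t \<in> {0..1} \<longrightarrow> \<bar>h j t\<bar> \<le> B)) \<and>
        (AE t in lborel. t \<in> {0..1} \<longrightarrow>
           (\<forall>l\<in>{1..n}. ((\<lambda>\<tau>. \<gamma> \<tau> l) has_real_derivative
               (\<Sum>j=1..r. h j t * hvf r n K j (\<gamma> t) l)) (at t))))"

end

theory Submission
  imports Defs
begin

text \<open>By Lazard elimination, on the subspace where \<open>x 1, \<dots>, x k\<close> vanish the Hall fields that
  remain as generators after eliminating \<open>X 1, \<dots>, X k\<close> are given by the explicit Grayson-Grossman
  formula. In particular \<open>X l\<close> is the \<open>l\<close>-th coordinate field at the origin, so the structure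
  constants are read off there.
  The extremal polynomials are the coadjoint orbit of \<open>v\<close> in coordinates of the second kind:
  \<open>P i x = v (Ad (exp (x n * X n)) \<dots> (Ad (exp (x 1 * X 1)) (X i)))\<close>. Left invariance gives
  \<open>X j (P i) = - (\<Sum>k. c i j k * P k)\<close> for the generators \<open>X j\<close>, so \<open>P i\<close> solves the
  adjoint equation along every horizontal curve, and a Gronwall argument gives uniqueness.\<close>

section \<open>Polynomial functions and polynomial vector fields\<close>

text \<open>For \<open>l > r\<close> the field \<open>X l\<close> is given only as an iterated
  bracket, and no closed formula for it is available on all of R^n. What is known explicitly lives
  on the subspaces where the first \<open>k\<close> coordinates vanish. Left invariance is therefore
  proved by downward induction on \<open>k\<close>, at stage \<open>k\<close> only for the
  generators in \<open>elim k\<close> and only on that subspace. At \<open>k = 0\<close> the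
  subspace is everything and the generators are \<open>X 1, \<dots>, X r\<close>. This suffices,
  since the velocity of a horizontal curve involves no other fields. The constants \<open>sc\<close>
  and \<open>gsc\<close> are definite descriptions: Hall rewriting supplies existence of the
  coefficients, evaluation at the origin their uniqueness. All nilpotency is obtained from weighted
  homogeneity with \<open>x j\<close> of weight \<open>dg j\<close>: a field of degree above
  \<open>s\<close> is zero, which ends the rewriting, truncates the exponentials and makes the
  series for \<open>Pext\<close> finite.\<close>

inductive polyfun :: "nat \<Rightarrow> ((nat \<Rightarrow> real) \<Rightarrow> real) \<Rightarrow> bool" for n where
  polyfun_const: "polyfun n (\<lambda>_. c)"
| polyfun_var: "j \<in> {1..n} \<Longrightarrow> polyfun n (\<lambda>x. x j)"
| polyfun_add: "polyfun n f \<Longrightarrow> polyfun n g \<Longrightarrow> polyfun n (\<lambda>x. f x + g x)"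
| polyfun_mult: "polyfun n f \<Longrightarrow> polyfun n g \<Longrightarrow> polyfun n (\<lambda>x. f x * g x)"

lemma polyfun_minus: "polyfun n f \<Longrightarrow> polyfun n (\<lambda>x. - f x)"
  using polyfun_mult[OF polyfun_const[of n "-1"]] by simp

lemma polyfun_diff: "polyfun n f \<Longrightarrow> polyfun n g \<Longrightarrow> polyfun n (\<lambda>x. f x - g x)"
  using polyfun_add[OF _ polyfun_minus] by simp

lemma polyfun_sum: "(\<And>i. i \<in> A \<Longrightarrow> polyfun n (f i)) \<Longrightarrow> polyfun n (\<lambda>x. \<Sum>i\<in>A. f i x)"
  by (induction A rule: infinite_finite_induct) (auto intro: polyfun_const polyfun_add)

lemma polyfun_power: "polyfun n f \<Longrightarrow> polyfun n (\<lambda>x. f x ^ p)"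
  by (induction p) (auto intro: polyfun_const polyfun_mult)

text \<open>Points are functions on all of \<open>nat\<close>; the start of the curve is known to
  vanish only on \<open>{1..n}\<close>, while values at the origin are computed at
  \<open>\<lambda>_. 0\<close>.\<close>

lemma polyfun_cong_coords:
  "polyfun n f \<Longrightarrow> (\<And>j. j \<in> {1..n} \<Longrightarrow> x j = y j) \<Longrightarrow> f x = f y"
  by (induction rule: polyfun.induct) auto

lemma pd_eqI:
  "((\<lambda>t. f (x(k := t))) has_real_derivative D) (at (x k)) \<Longrightarrow> pd f k x = D"
  unfolding pd_def by (rule DERIV_imp_deriv)

lemma pd_const [simp]: "pd (\<lambda>_. c) k x = 0"
  by (rule pd_eqI) simp

lemma pd_coord: "pd (\<lambda>x. x j) k x = (if j = k then 1 else 0)"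
  by (rule pd_eqI) (auto intro: derivative_eq_intros)

text \<open>Closure under \<open>pd\<close> needs the product rule, hence differentiability of the
  factors, so both claims share one induction.\<close>

lemma polyfun_derivative_and_pd:
  "polyfun n f \<Longrightarrow>
    (\<forall>x. ((\<lambda>t. f (x(k := t))) has_real_derivative pd f k x) (at (x k))) \<and> polyfun n (pd f k)"
proof (induction rule: polyfun.induct)
  case (polyfun_const c)
  then show ?case by (auto simp: pd_const[abs_def] intro: polyfun.intros)
next
  case (polyfun_var j)
  have "polyfun n (pd (\<lambda>x. x j) k)"
    unfolding pd_coord[abs_def] by (rule polyfun.intros)
  moreover have "((\<lambda>t. (x(k := t)) j) has_real_derivative pd (\<lambda>x. x j) k x) (at (x k))" for x
    by (auto simp: pd_coord intro: derivative_eq_intros)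
  ultimately show ?case by blast
next
  case (polyfun_add f g)
  have D: "((\<lambda>t. f (x(k := t)) + g (x(k := t))) has_real_derivative pd f k x + pd g k x) (at (x k))" for x
    using polyfun_add.IH by (intro DERIV_add) blast+
  then have "pd (\<lambda>x. f x + g x) k = (\<lambda>x. pd f k x + pd g k x)"
    by (intro ext pd_eqI)
  moreover have "polyfun n (\<lambda>x. pd f k x + pd g k x)"
    using polyfun_add.IH by (intro polyfun.polyfun_add) blast+
  ultimately show ?case using D by presburger
next
  case (polyfun_mult f g)
  have D: "((\<lambda>t. f (x(k := t)) * g (x(k := t))) has_real_derivative pd f k x * g x + pd g k x * f x) (at (x k))" for x
    using DERIV_mult[of "\<lambda>t. f (x(k := t))" "pd f k x" "x k" UNIV "\<lambda>t. g (x(k := t))" "pd g k x"]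
      polyfun_mult.IH by auto
  then have "pd (\<lambda>x. f x * g x) k = (\<lambda>x. pd f k x * g x + pd g k x * f x)"
    by (intro ext pd_eqI)
  moreover have "polyfun n (\<lambda>x. pd f k x * g x + pd g k x * f x)"
    using polyfun_mult by (intro polyfun.polyfun_add polyfun.polyfun_mult) blast+
  ultimately show ?case using D by presburger
qed

lemma polyfun_has_derivative:
  "polyfun n f \<Longrightarrow> ((\<lambda>t. f (x(k := t))) has_real_derivative pd f k x) (at (x k))"
  using polyfun_derivative_and_pd by blast

lemma polyfun_pd: "polyfun n f \<Longrightarrow> polyfun n (pd f k)"
  using polyfun_derivative_and_pd by blast

lemma pd_add:
  assumes "polyfun n f" "polyfun n g"
  shows "pd (\<lambda>x. f x + g x) k x = pd f k x + pd g k x"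
  using assms by (intro pd_eqI DERIV_add polyfun_has_derivative)

lemma pd_diff:
  assumes "polyfun n f" "polyfun n g"
  shows "pd (\<lambda>x. f x - g x) k x = pd f k x - pd g k x"
  using assms by (intro pd_eqI DERIV_diff polyfun_has_derivative)

lemma pd_mult:
  assumes "polyfun n f" "polyfun n g"
  shows "pd (\<lambda>x. f x * g x) k x = pd f k x * g x + f x * pd g k x"
  using DERIV_mult[OF polyfun_has_derivative[OF assms(1), of x k] polyfun_has_derivative[OF assms(2), of x k]]
  by (intro pd_eqI) (simp add: algebra_simps)

lemma pd_sum:
  assumes "\<And>i. i \<in> A \<Longrightarrow> polyfun n (f i)"
  shows "pd (\<lambda>x. \<Sum>i\<in>A. f i x) k x = (\<Sum>i\<in>A. pd (f i) k x)"
  using assms by (intro pd_eqI DERIV_sum polyfun_has_derivative)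

lemma pd_cmult: "polyfun n f \<Longrightarrow> pd (\<lambda>x. c * f x) k x = c * pd f k x"
  using pd_mult[OF polyfun_const] by simp

text \<open>For polynomials the symmetry is algebraic: it passes through sums and products by the
  Leibniz rule.\<close>

lemma pd_commute: "polyfun n f \<Longrightarrow> pd (pd f i) j x = pd (pd f j) i x"
proof (induction arbitrary: x rule: polyfun.induct)
  case (polyfun_const c)
  then show ?case by (simp add: pd_const[abs_def])
next
  case (polyfun_var l)
  then show ?case by (simp add: pd_coord[abs_def])
next
  case (polyfun_add f g)
  have "pd (\<lambda>x. f x + g x) k = (\<lambda>x. pd f k x + pd g k x)" for k
    using polyfun_add.hyps by (intro ext pd_add)
  then show ?case using polyfun_add by (simp add: pd_add[of n] polyfun_pd)
next
  case (polyfun_mult f g)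
  have *: "pd (\<lambda>x. f x * g x) k = (\<lambda>x. pd f k x * g x + f x * pd g k x)" for k
    using polyfun_mult.hyps by (intro ext pd_mult)
  have "pd (\<lambda>x. pd f k x * g x + f x * pd g k x) l x
      = (pd (pd f k) l x * g x + pd f k x * pd g l x) + (pd f l x * pd g k x + f x * pd (pd g k) l x)" for k l
    using polyfun_mult.hyps
    by (simp add: pd_add[of n] pd_mult[of n] polyfun.polyfun_mult polyfun_pd)
  then show ?case using polyfun_mult.IH by (simp add: *)
qed

text \<open>Differentiability is asked at the single time \<open>t\<close> only, because a
  horizontal curve has a derivative merely almost everywhere.\<close>

lemma polyfun_chain_rule:
  assumes "polyfun n f"
    and "\<And>l. l \<in> {1..n} \<Longrightarrow> ((\<lambda>\<tau>. \<gamma> \<tau> l) has_real_derivative D l) (at t)"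
  shows "((\<lambda>\<tau>. f (\<gamma> \<tau>)) has_real_derivative (\<Sum>l=1..n. D l * pd f l (\<gamma> t))) (at t)"
  using assms(1)
proof (induction rule: polyfun.induct)
  case (polyfun_var j)
  have "(\<Sum>l=1..n. D l * pd (\<lambda>x. x j) l (\<gamma> t)) = (\<Sum>l=1..n. if j = l then D l else 0)"
    by (intro sum.cong) (auto simp: pd_coord)
  then show ?case using polyfun_var assms(2) by simp
next
  case (polyfun_add f g)
  have "(\<Sum>l=1..n. D l * pd (\<lambda>x. f x + g x) l (\<gamma> t))
     = (\<Sum>l=1..n. D l * pd f l (\<gamma> t)) + (\<Sum>l=1..n. D l * pd g l (\<gamma> t))"
    using polyfun_add by (simp add: pd_add[of n] algebra_simps sum.distrib)
  then show ?case using DERIV_add[OF polyfun_add.IH] by simp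
next
  case (polyfun_mult f g)
  have "(\<Sum>l=1..n. D l * pd (\<lambda>x. f x * g x) l (\<gamma> t))
     = (\<Sum>l=1..n. D l * pd f l (\<gamma> t)) * g (\<gamma> t) + (\<Sum>l=1..n. D l * pd g l (\<gamma> t)) * f (\<gamma> t)"
    using polyfun_mult by (simp add: pd_mult[of n] algebra_simps sum.distrib sum_distrib_left)
  then show ?case using DERIV_mult[OF polyfun_mult.IH] by simp
qed auto

section \<open>Weighted homogeneous polynomials\<close>

text \<open>The degree is an integer, so that the fields of large degree are forced to have components of
  negative degree, which vanish.\<close>

inductive hompoly :: "nat \<Rightarrow> (nat \<Rightarrow> nat) \<Rightarrow> int \<Rightarrow> ((nat \<Rightarrow> real) \<Rightarrow> real) \<Rightarrow> bool" for n w where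
  hompoly_zero: "hompoly n w d (\<lambda>_. 0)"
| hompoly_const: "hompoly n w 0 (\<lambda>_. c)"
| hompoly_var: "j \<in> {1..n} \<Longrightarrow> hompoly n w (int (w j)) (\<lambda>x. x j)"
| hompoly_add: "hompoly n w d f \<Longrightarrow> hompoly n w d g \<Longrightarrow> hompoly n w d (\<lambda>x. f x + g x)"
| hompoly_mult: "hompoly n w d f \<Longrightarrow> hompoly n w e g \<Longrightarrow> hompoly n w (d + e) (\<lambda>x. f x * g x)"

lemma hompoly_imp_polyfun: "hompoly n w d f \<Longrightarrow> polyfun n f"
  by (induction rule: hompoly.induct) (auto intro: polyfun.intros)

text \<open>In a product of negative total degree one factor already has negative degree.\<close>

lemma hompoly_neg_degree: "hompoly n w d f \<Longrightarrow> d < 0 \<Longrightarrow> f x = 0"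
proof (induction rule: hompoly.induct)
  case (hompoly_mult d f e g)
  then show ?case by (cases "d < 0") auto
qed auto

lemma hompoly_mult': "hompoly n w d f \<Longrightarrow> hompoly n w e g \<Longrightarrow> d + e = d' \<Longrightarrow> hompoly n w d' (\<lambda>x. f x * g x)"
  using hompoly_mult by blast

lemma hompoly_cmult: "hompoly n w d f \<Longrightarrow> hompoly n w d (\<lambda>x. c * f x)"
  using hompoly_mult[OF hompoly_const] by fastforce

lemma hompoly_minus: "hompoly n w d f \<Longrightarrow> hompoly n w d (\<lambda>x. - f x)"
  using hompoly_cmult[of n w d f "-1"] by simp

lemma hompoly_diff: "hompoly n w d f \<Longrightarrow> hompoly n w d g \<Longrightarrow> hompoly n w d (\<lambda>x. f x - g x)"
  using hompoly_add[OF _ hompoly_minus] by simp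

lemma hompoly_sum: "(\<And>i. i \<in> A \<Longrightarrow> hompoly n w d (f i)) \<Longrightarrow> hompoly n w d (\<lambda>x. \<Sum>i\<in>A. f i x)"
  by (induction A rule: infinite_finite_induct) (auto intro: hompoly_zero hompoly_add)

lemma hompoly_power: "hompoly n w d f \<Longrightarrow> hompoly n w (int p * d) (\<lambda>x. f x ^ p)"
proof (induction p)
  case 0
  then show ?case using hompoly_const[of n w 1] by simp
next
  case (Suc p)
  then show ?case by (auto intro!: hompoly_mult' simp: algebra_simps)
qed

lemma hompoly_prod:
  "finite A \<Longrightarrow> (\<And>i. i \<in> A \<Longrightarrow> hompoly n w (d i) (f i)) \<Longrightarrow>
    hompoly n w (\<Sum>i\<in>A. d i) (\<lambda>x. \<Prod>i\<in>A. f i x)"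
  by (induction A rule: finite_induct) (auto intro: hompoly_const hompoly_mult)

lemma hompoly_pd: "hompoly n w d f \<Longrightarrow> hompoly n w (d - int (w k)) (pd f k)"
proof (induction rule: hompoly.induct)
  case (hompoly_var j)
  show ?case
  proof (cases "j = k")
    case True
    then have "pd (\<lambda>x. x j) k = (\<lambda>_. 1)" by (simp add: pd_coord fun_eq_iff)
    then show ?thesis using hompoly_const[of n w 1] True by simp
  next
    case False
    then have "pd (\<lambda>x. x j) k = (\<lambda>_. 0)" by (simp add: pd_coord fun_eq_iff)
    then show ?thesis using hompoly_zero by simp
  qed
next
  case (hompoly_add d f g)
  have "pd (\<lambda>x. f x + g x) k = (\<lambda>x. pd f k x + pd g k x)"
    using hompoly_add.hyps by (intro ext pd_add hompoly_imp_polyfun)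
  then show ?case using hompoly_add.IH hompoly.hompoly_add by metis
next
  case (hompoly_mult d f e g)
  have "pd (\<lambda>x. f x * g x) k = (\<lambda>x. pd f k x * g x + f x * pd g k x)"
    using hompoly_mult.hyps by (intro ext pd_mult hompoly_imp_polyfun)
  moreover have "hompoly n w (d + e - int (w k)) (\<lambda>x. pd f k x * g x + f x * pd g k x)"
    using hompoly_mult by (intro hompoly.hompoly_add hompoly_mult') (auto)
  ultimately show ?case by simp
qed (auto simp: pd_const[abs_def] intro: hompoly_zero)

section \<open>Lie derivatives and brackets of polynomial fields\<close>

definition lie_deriv :: "nat \<Rightarrow> vfield \<Rightarrow> ((nat \<Rightarrow> real) \<Rightarrow> real) \<Rightarrow> (nat \<Rightarrow> real) \<Rightarrow> real" where
  "lie_deriv n V f = (\<lambda>x. \<Sum>k=1..n. V x k * pd f k x)"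

text \<open>Components outside \<open>{1..n}\<close> are fixed to zero so that identities between
  fields hold as equations of functions and can be used for rewriting inside brackets.\<close>

definition polyfield :: "nat \<Rightarrow> vfield \<Rightarrow> bool" where
  "polyfield n V \<longleftrightarrow> (\<forall>l. polyfun n (\<lambda>x. V x l)) \<and> (\<forall>l x. l \<notin> {1..n} \<longrightarrow> V x l = 0)"

lemma polyfield_comp: "polyfield n V \<Longrightarrow> polyfun n (\<lambda>x. V x l)"
  by (simp add: polyfield_def)

lemma polyfield_outside: "polyfield n V \<Longrightarrow> l \<notin> {1..n} \<Longrightarrow> V x l = 0"
  by (simp add: polyfield_def)

lemma vf_bracket_lie_deriv:
  "vf_bracket n V W x l = lie_deriv n V (\<lambda>y. W y l) x - lie_deriv n W (\<lambda>y. V y l) x"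
  by (simp add: vf_bracket_def lie_deriv_def sum_subtractf)

lemma polyfun_lie_deriv: "polyfield n V \<Longrightarrow> polyfun n f \<Longrightarrow> polyfun n (lie_deriv n V f)"
  unfolding lie_deriv_def by (rule polyfun_sum, rule polyfun_mult, erule polyfield_comp, erule polyfun_pd)

lemma lie_deriv_diff:
  "polyfun n f \<Longrightarrow> polyfun n g \<Longrightarrow>
    lie_deriv n V (\<lambda>x. f x - g x) x = lie_deriv n V f x - lie_deriv n V g x"
  by (simp add: lie_deriv_def pd_diff[of n] sum_subtractf algebra_simps)

lemma polyfield_vf_bracket:
  assumes "polyfield n V" "polyfield n W"
  shows "polyfield n (vf_bracket n V W)"
proof -
  have "lie_deriv n Z (\<lambda>y. U y l) x = 0" if "polyfield n U" "l \<notin> {1..n}" for Z U l x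
  proof -
    have "(\<lambda>y. U y l) = (\<lambda>_. 0)"
      using that by (simp add: polyfield_outside fun_eq_iff)
    then show ?thesis by (simp add: lie_deriv_def)
  qed
  moreover have "polyfun n (\<lambda>x. vf_bracket n V W x l)" for l
    unfolding vf_bracket_lie_deriv
    using assms by (intro polyfun_diff polyfun_lie_deriv polyfield_comp[OF assms(1)] polyfield_comp[OF assms(2)])
  ultimately show ?thesis
    using assms by (simp add: polyfield_def[of n "vf_bracket n V W"] vf_bracket_lie_deriv)
qed

text \<open>Each composition splits into a first order part and a second order part; the second
  order parts cancel by \<open>pd_commute\<close>.\<close>

lemma lie_deriv_bracket:
  assumes V: "polyfield n V" and W: "polyfield n W" and f: "polyfun n f"
  shows "lie_deriv n (vf_bracket n V W) f x
    = lie_deriv n V (lie_deriv n W f) x - lie_deriv n W (lie_deriv n V f) x"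
proof -
  have second: "lie_deriv n U (lie_deriv n Z f) x
      = (\<Sum>q=1..n. lie_deriv n U (\<lambda>y. Z y q) x * pd f q x)
        + (\<Sum>q=1..n. \<Sum>k=1..n. U x k * Z x q * pd (pd f q) k x)"
    if "polyfield n U" "polyfield n Z" for U Z
  proof -
    have "pd (lie_deriv n Z f) k x = (\<Sum>q=1..n. pd (\<lambda>y. Z y q) k x * pd f q x + Z x q * pd (pd f q) k x)" for k
      unfolding lie_deriv_def using that f
      by (subst pd_sum[of _ n])
        (auto intro!: polyfun_mult polyfield_comp[OF that(2)] polyfun_pd simp: pd_mult[of n] polyfield_comp polyfun_pd)
    then have "lie_deriv n U (lie_deriv n Z f) x
      = (\<Sum>k=1..n. \<Sum>q=1..n. U x k * pd (\<lambda>y. Z y q) k x * pd f q x + U x k * Z x q * pd (pd f q) k x)"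
      unfolding lie_deriv_def[of n U] by (simp add: sum_distrib_left algebra_simps)
    also have "\<dots> = (\<Sum>q=1..n. \<Sum>k=1..n. U x k * pd (\<lambda>y. Z y q) k x * pd f q x + U x k * Z x q * pd (pd f q) k x)"
      by (rule sum.swap)
    finally show ?thesis
      by (simp add: sum.distrib lie_deriv_def sum_distrib_right)
  qed
  have "(\<Sum>q=1..n. \<Sum>k=1..n. V x k * W x q * pd (pd f q) k x)
      = (\<Sum>k=1..n. \<Sum>q=1..n. V x k * W x q * pd (pd f q) k x)"
    by (rule sum.swap)
  also have "\<dots> = (\<Sum>q=1..n. \<Sum>k=1..n. W x k * V x q * pd (pd f q) k x)"
    using pd_commute[OF f] by (simp add: mult.commute)
  finally show ?thesis
    unfolding second[OF V W] second[OF W V]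
    by (simp add: lie_deriv_def[of n "vf_bracket n V W"] vf_bracket_lie_deriv left_diff_distrib sum_subtractf)
qed

text \<open>By \<open>lie_deriv_bracket\<close> every double bracket becomes a signed sum of twofold
  Lie derivatives of components, and these cancel. The Leibniz form is the one that Hall rewriting
  and left invariance use.\<close>

lemma vf_bracket_jacobi:
  assumes U: "polyfield n U" and V: "polyfield n V" and W: "polyfield n W"
  shows "vf_bracket n (vf_bracket n U V) W x l
    = vf_bracket n (vf_bracket n U W) V x l + vf_bracket n U (vf_bracket n V W) x l"
proof -
  have expand: "vf_bracket n A (vf_bracket n B C) x l =
      lie_deriv n A (lie_deriv n B (\<lambda>y. C y l)) x - lie_deriv n A (lie_deriv n C (\<lambda>y. B y l)) x
      - (lie_deriv n B (lie_deriv n C (\<lambda>y. A y l)) x - lie_deriv n C (lie_deriv n B (\<lambda>y. A y l)) x)"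
    if "polyfield n A" "polyfield n B" "polyfield n C" for A B C
    using that unfolding vf_bracket_lie_deriv[of n A]
    by (subst lie_deriv_bracket) (auto simp: vf_bracket_lie_deriv lie_deriv_diff polyfun_lie_deriv polyfield_comp)
  have anti: "vf_bracket n A B x l = - vf_bracket n B A x l" for A B
    by (simp add: vf_bracket_lie_deriv)
  show ?thesis
    unfolding anti[of "vf_bracket n U V"] anti[of "vf_bracket n U W"]
    using U V W by (simp add: expand)
qed

lemma vf_bracket_antisym: "vf_bracket n V W = (\<lambda>x l. - vf_bracket n W V x l)"
  by (simp add: vf_bracket_lie_deriv fun_eq_iff)

lemma polyfield_lincomb:
  "(\<And>k. k \<in> A \<Longrightarrow> polyfield n (V k)) \<Longrightarrow> polyfield n (\<lambda>x l. \<Sum>k\<in>A. c k * V k x l)"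
  unfolding polyfield_def by (auto intro!: polyfun_sum polyfun_mult polyfun_const)

lemma vf_bracket_lincomb_left:
  assumes "\<And>k. k \<in> A \<Longrightarrow> polyfield n (V k)"
  shows "vf_bracket n (\<lambda>x l. \<Sum>k\<in>A. c k * V k x l) W x l = (\<Sum>k\<in>A. c k * vf_bracket n (V k) W x l)"
proof -
  have "pd (\<lambda>y. \<Sum>k\<in>A. c k * V k y l) q x = (\<Sum>k\<in>A. c k * pd (\<lambda>y. V k y l) q x)" for q
    using polyfield_comp[OF assms]
    by (subst pd_sum[of _ n]) (simp_all add: pd_cmult[of n] polyfun_mult polyfun_const)
  then have "lie_deriv n W (\<lambda>y. \<Sum>k\<in>A. c k * V k y l) x = (\<Sum>k\<in>A. c k * lie_deriv n W (\<lambda>y. V k y l) x)"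
    unfolding lie_deriv_def sum_distrib_left
    by (subst sum.swap) (simp add: sum_distrib_left mult.left_commute)
  moreover have "lie_deriv n (\<lambda>x l. \<Sum>k\<in>A. c k * V k x l) f x = (\<Sum>k\<in>A. c k * lie_deriv n (V k) f x)" for f
    unfolding lie_deriv_def sum_distrib_left sum_distrib_right
    by (subst sum.swap) (simp add: mult.assoc)
  ultimately show ?thesis
    by (simp add: vf_bracket_lie_deriv right_diff_distrib sum_subtractf)
qed

lemma vf_bracket_lincomb_right:
  assumes "\<And>k. k \<in> A \<Longrightarrow> polyfield n (V k)"
  shows "vf_bracket n W (\<lambda>x l. \<Sum>k\<in>A. c k * V k x l) x l = (\<Sum>k\<in>A. c k * vf_bracket n W (V k) x l)"
  using vf_bracket_lincomb_left[of A n V c W x l, OF assms] 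
  by (subst (1 2) vf_bracket_antisym) (simp add: sum_negf)

text \<open>The partial derivative in direction \<open>l\<close> lowers the weight by
  \<open>w l\<close>; for the field to lower it by \<open>d\<close>, its \<open>l\<close>-th
  coefficient must have degree \<open>w l - d\<close>.\<close>

definition homfield :: "nat \<Rightarrow> (nat \<Rightarrow> nat) \<Rightarrow> nat \<Rightarrow> vfield \<Rightarrow> bool" where
  "homfield n w d V \<longleftrightarrow> polyfield n V \<and> (\<forall>l. hompoly n w (int (w l) - int d) (\<lambda>x. V x l))"

lemma homfield_polyfield: "homfield n w d V \<Longrightarrow> polyfield n V"
  by (simp add: homfield_def)

lemma homfield_vf_bracket:
  assumes "homfield n w d V" "homfield n w e W"
  shows "homfield n w (d + e) (vf_bracket n V W)"
proof -
  have "hompoly n w (int (w l) - int (d + e)) (\<lambda>x. vf_bracket n V W x l)" for l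
    unfolding vf_bracket_lie_deriv lie_deriv_def
  proof (intro hompoly_diff hompoly_sum)
    fix k
    have "hompoly n w (int (w q) - int d) (\<lambda>x. V x q)" "hompoly n w (int (w q) - int e) (\<lambda>x. W x q)" for q
      using assms by (auto simp: homfield_def)
    note * = this hompoly_pd[OF this(1)[of l], of k] hompoly_pd[OF this(2)[of l], of k]
    show "hompoly n w (int (w l) - int (d + e)) (\<lambda>x. V x k * pd (\<lambda>y. W y l) k x)"
      by (rule hompoly_mult'[OF *(1)[of k] *(4)]) simp
    show "hompoly n w (int (w l) - int (d + e)) (\<lambda>x. W x k * pd (\<lambda>y. V y l) k x)"
      by (rule hompoly_mult'[OF *(2)[of k] *(3)]) simp
  qed
  then show ?thesis
    using assms polyfield_vf_bracket by (auto simp: homfield_def)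
qed

lemma homfield_large_degree:
  assumes "homfield n w d V" "\<And>l. l \<in> {1..n} \<Longrightarrow> w l < d"
  shows "V = (\<lambda>_ _. 0)"
proof (intro ext)
  fix x l
  show "V x l = 0"
  proof (cases "l \<in> {1..n}")
    case True
    then show ?thesis
      using assms hompoly_neg_degree[of n w "int (w l) - int d" "\<lambda>x. V x l"] by (force simp: homfield_def)
  next
    case False
    then show ?thesis using assms by (auto simp: homfield_def polyfield_def)
  qed
qed

section \<open>The Grayson-Grossman fields\<close>

text \<open>The exponents are given by a list of letters instead of a multi-index, so that
  lengthening or shortening a Hall string acts directly on the monomial.\<close>

definition signed_monomial :: "nat \<Rightarrow> (nat \<Rightarrow> real) \<Rightarrow> nat list \<Rightarrow> real" where
  "signed_monomial n x ys = (\<Prod>j=1..n. (- x j) ^ count_list ys j / fact (count_list ys j))"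

lemma signed_monomial_Nil [simp]: "signed_monomial n x [] = 1"
  by (simp add: signed_monomial_def)

lemma signed_monomial_altdef:
  "signed_monomial n x ys
    = (-1) ^ mabs n (count_list ys) / mfact n (count_list ys) * mpow n x (count_list ys)"
proof -
  have "(- x j) ^ c = (-1) ^ c * x j ^ c" for j c
    by (rule power_minus)
  then show ?thesis
    by (simp only: signed_monomial_def mabs_def mfact_def mpow_def power_sum prod_dividef prod.distrib)
      simp
qed

lemma signed_monomial_eq_0:
  "b \<in> set ys \<Longrightarrow> b \<in> {1..n} \<Longrightarrow> x b = 0 \<Longrightarrow> signed_monomial n x ys = 0"
  unfolding signed_monomial_def
  by (rule prod_zero) (auto intro!: bexI[of _ b] simp: zero_less_iff_neq_zero count_list_0_iff)

lemma signed_monomial_upd: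
  "m \<notin> set ys \<Longrightarrow> signed_monomial n (x(m := t)) ys = signed_monomial n x ys"
  unfolding signed_monomial_def by (intro prod.cong) (auto simp: count_list_0_iff)

lemma pd_signed_monomial_notin:
  "m \<notin> set ys \<Longrightarrow> pd (\<lambda>y. signed_monomial n y ys) m x = 0"
  by (rule pd_eqI) (simp add: signed_monomial_upd)

text \<open>The divided power \<open>(- t) ^ c / fact c\<close> differentiates to minus its
  predecessor; this is the role of the factorials in the Grayson-Grossman formula.\<close>

lemma pd_signed_monomial_Cons:
  assumes "m \<in> {1..n}"
  shows "pd (\<lambda>y. signed_monomial n y (m # ys)) m x = - signed_monomial n x ys"
proof (rule pd_eqI)
  define c where "c = count_list ys m"
  define R where "R = (\<Prod>j\<in>{1..n}-{m}. (- x j) ^ count_list ys j / fact (count_list ys j))"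
  have split: "signed_monomial n (x(m := t)) zs = (- t) ^ count_list zs m / fact (count_list zs m) *
      (\<Prod>j\<in>{1..n}-{m}. (- x j) ^ count_list zs j / fact (count_list zs j))" for t zs
    unfolding signed_monomial_def using assms
    by (subst prod.remove[of _ m]) (auto intro!: prod.cong)
  have "(\<Prod>j\<in>{1..n}-{m}. (- x j) ^ count_list (m # ys) j / fact (count_list (m # ys) j)) = R"
    unfolding R_def by (intro prod.cong) auto
  then have 1: "signed_monomial n (x(m := t)) (m # ys) = (- t) ^ Suc c / fact (Suc c) * R" for t
    unfolding split[of t "m # ys"] by (simp add: c_def)
  have 2: "signed_monomial n x ys = (- x m) ^ c / fact c * R"
    using split[of "x m" ys] by (simp add: R_def c_def)
  have "((\<lambda>t. (- t) ^ Suc c / fact (Suc c) * R) has_real_derivative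
      real (Suc c) * (- x m) ^ c * (-1) / fact (Suc c) * R) (at (x m))"
    by (rule derivative_eq_intros refl | simp)+
  also have "real (Suc c) * (- x m) ^ c * (-1) / fact (Suc c) * R = - signed_monomial n x ys"
    unfolding 2 fact_Suc by (simp add: field_simps del: of_nat_Suc)
  finally show "((\<lambda>t. signed_monomial n (x(m := t)) (m # ys)) has_real_derivative
      - signed_monomial n x ys) (at (x m))"
    unfolding 1 .
qed

lemma hompoly_signed_monomial:
  "hompoly n w (int (\<Sum>j=1..n. count_list ys j * w j)) (\<lambda>x. signed_monomial n x ys)"
proof -
  have "hompoly n w (\<Sum>j=1..n. int (count_list ys j) * int (w j)) (\<lambda>x. signed_monomial n x ys)"
    unfolding signed_monomial_def
  proof (rule hompoly_prod)
    fix j assume "j \<in> {1..n}"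
    then have "hompoly n w (int (count_list ys j) * int (w j)) (\<lambda>x. (- x j) ^ count_list ys j)"
      by (intro hompoly_power hompoly_minus hompoly_var)
    from hompoly_cmult[OF this, of "1 / fact (count_list ys j)"]
    show "hompoly n w (int (count_list ys j) * int (w j))
        (\<lambda>x. (- x j) ^ count_list ys j / fact (count_list ys j))"
      by simp
  qed simp
  then show ?thesis by simp
qed

section \<open>Hall bases and their strings\<close>

locale hall =
  fixes r s n :: nat and K :: "nat \<Rightarrow> nat \<times> nat" and dg :: "nat \<Rightarrow> nat"
  assumes basis: "hall_basis r s n K dg" and rank_ge_2: "2 \<le> r"
begin

abbreviation str :: "nat \<Rightarrow> nat list" where "str \<equiv> hstr r K"
abbreviation X :: "nat \<Rightarrow> vfield" where "X \<equiv> hvf r n K"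
abbreviation br :: "vfield \<Rightarrow> vfield \<Rightarrow> vfield" where "br \<equiv> vf_bracket n"
abbreviation homog :: "nat \<Rightarrow> vfield \<Rightarrow> bool" where "homog \<equiv> homfield n dg"

lemma rank_le_dim: "r \<le> n"
  using basis by (simp add: hall_basis_def)

lemma dg_generator: "l \<in> {1..r} \<Longrightarrow> dg l = 1"
  using basis by (simp add: hall_basis_def)

lemma dg_mono: "l \<in> {1..n} \<Longrightarrow> m \<in> {1..n} \<Longrightarrow> l \<le> m \<Longrightarrow> dg l \<le> dg m"
  using basis unfolding hall_basis_def by meson

lemma dg_le_step: "l \<in> {1..n} \<Longrightarrow> dg l \<le> s"
  using basis unfolding hall_basis_def by meson

lemma dg_pos: "l \<in> {1..n} \<Longrightarrow> 1 \<le> dg l"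
  using dg_mono[of 1 l] dg_generator[of 1] rank_ge_2 rank_le_dim by auto

lemma K_bracket:
  assumes "l \<in> {r+1..n}" "K l = (a, b)"
  shows "a \<in> {1..n}" "b \<in> {1..n}" "b < a" "a < l" "dg l = dg a + dg b" "r < a \<Longrightarrow> snd (K a) \<le> b"
proof -
  have "1 \<le> snd (K l) \<and> snd (K l) < fst (K l) \<and> fst (K l) < l \<and>
        dg l = dg (fst (K l)) + dg (snd (K l)) \<and>
        (r < fst (K l) \<longrightarrow> snd (K (fst (K l))) \<le> snd (K l))"
    using basis assms(1) unfolding hall_basis_def by meson
  then show "a \<in> {1..n}" "b \<in> {1..n}" "b < a" "a < l" "dg l = dg a + dg b" "r < a \<Longrightarrow> snd (K a) \<le> b"
    using assms by auto
qed

lemma K_inj: "l \<in> {r+1..n} \<Longrightarrow> m \<in> {r+1..n} \<Longrightarrow> K l = K m \<Longrightarrow> l = m"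
  using basis unfolding hall_basis_def inj_on_def by meson

lemma K_complete:
  assumes "a \<in> {1..n}" "b \<in> {1..n}" "b < a" "dg a + dg b \<le> s" "r < a \<Longrightarrow> snd (K a) \<le> b"
  obtains l where "l \<in> {r+1..n}" "K l = (a, b)"
  using basis assms unfolding hall_basis_def by meson

lemma hall_induct [consumes 1, case_names generator bracket]:
  assumes "l \<in> {1..n}"
    and "\<And>l. l \<in> {1..r} \<Longrightarrow> P l"
    and "\<And>l a b. l \<in> {r+1..n} \<Longrightarrow> K l = (a, b) \<Longrightarrow> P a \<Longrightarrow> P b \<Longrightarrow> P l"
  shows "P l"
  using assms(1)
proof (induction l rule: less_induct)
  case (less l)
  show ?case
  proof (cases "l \<le> r")
    case True
    then show ?thesis using less.prems assms(2) by simp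
  next
    case False
    then have l: "l \<in> {r+1..n}" using less.prems by simp
    obtain a b where ab: "K l = (a, b)" by fastforce
    show ?thesis
      using K_bracket[OF l ab] less.IH[of a] less.IH[of b] assms(3)[OF l ab] by simp
  qed
qed

lemma str_generator: "l \<le> r \<Longrightarrow> str l = [l]"
  by (subst hstr.simps) simp

lemma str_bracket: "l \<in> {r+1..n} \<Longrightarrow> K l = (a, b) \<Longrightarrow> str l = str a @ [b]"
  using K_bracket[of l a b] by (subst hstr.simps) auto

lemma X_generator: "l \<le> r \<Longrightarrow> X l = genvf r n K l"
  by (subst hvf.simps) simp

lemma X_bracket: "l \<in> {r+1..n} \<Longrightarrow> K l = (a, b) \<Longrightarrow> X l = br (X a) (X b)"
  using K_bracket[of l a b] by (subst hvf.simps) auto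

lemma str_nonempty: "l \<in> {1..n} \<Longrightarrow> str l \<noteq> []"
  by (induction rule: hall_induct) (auto simp: str_generator str_bracket)

text \<open>A string of length one belongs to a generator; a longer one determines its last letter
  and the string of the left factor, hence by induction the pair \<open>K l\<close>, on which
  \<open>K\<close> is injective.\<close>

lemma str_inj: "l \<in> {1..n} \<Longrightarrow> m \<in> {1..n} \<Longrightarrow> str l = str m \<Longrightarrow> l = m"
proof (induction arbitrary: m rule: hall_induct)
  case (generator l)
  show ?case
  proof (cases "m \<le> r")
    case True
    then show ?thesis using generator by (simp add: str_generator)
  next
    case False
    then have m: "m \<in> {r+1..n}" using generator by simp
    obtain a b where ab: "K m = (a, b)" by fastforce
    show ?thesis
      using generator str_nonempty[OF K_bracket(1)[OF m ab]] str_bracket[OF m ab] by (simp add: str_generator)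
  qed
next
  case (bracket l a b)
  note str_l = str_bracket[OF bracket.hyps(1,2)] and ne = str_nonempty[OF K_bracket(1)[OF bracket.hyps(1,2)]]
  show ?case
  proof (cases "m \<le> r")
    case True
    then show ?thesis using bracket.prems str_l ne by (simp add: str_generator)
  next
    case False
    then have m: "m \<in> {r+1..n}" using bracket.prems by simp
    obtain a' b' where ab: "K m = (a', b')" by fastforce
    have "str a = str a'" "b = b'"
      using bracket.prems str_l str_bracket[OF m ab] by simp_all
    moreover from this have "a = a'"
      using bracket.IH(1) K_bracket(1)[OF m ab] by simp
    ultimately show ?thesis
      using K_inj[OF bracket.hyps(1) m] bracket.hyps(2) ab by simp
  qed
qed

text \<open>The Hall condition \<open>snd (K a) \<le> b\<close> compares the last letter of the left
  factor with the appended one. The second conjunct is what makes this usable in the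
  induction.\<close>

lemma sorted_tl_str: "l \<in> {1..n} \<Longrightarrow> sorted (tl (str l)) \<and> (r < l \<longrightarrow> last (str l) = snd (K l))"
proof (induction rule: hall_induct)
  case (generator l)
  then show ?case by (simp add: str_generator)
next
  case (bracket l a b)
  note K = K_bracket[OF bracket.hyps(1,2)]
  have "x \<le> b" if "x \<in> set (tl (str a))" for x
  proof (cases "a \<le> r")
    case True
    then show ?thesis using that by (simp add: str_generator)
  next
    case False
    have ne: "tl (str a) \<noteq> []" using that by auto
    have "x \<le> last (tl (str a))"
      using that bracket.IH(1) ne by (cases "tl (str a)" rule: rev_cases) (auto simp: sorted_append)
    also have "\<dots> = snd (K a)" using bracket.IH(1) False ne by (simp add: last_tl)
    finally show ?thesis using K(6) False by simp
  qed
  then show ?case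
    using bracket K str_nonempty[OF K(1)] by (auto simp: str_bracket sorted_append)
qed

text \<open>Strings grow by one letter per bracket, so the initial segments of a string between
  \<open>i\<close> and \<open>l\<close> are strings of basis elements; the one right after
  \<open>i\<close> provides the next letter.\<close>

lemma str_prefix_step:
  assumes "l \<in> {1..n}" "i \<in> {1..n}" "prefix (str i) (str l)" "l \<noteq> i"
  shows "\<exists>i' b. i' \<in> {r+1..n} \<and> K i' = (i, b) \<and> prefix (str i') (str l) \<and> i < l"
  using assms
proof (induction rule: hall_induct)
  case (generator l)
  then have "str i = str l"
    using str_nonempty[of i] by (auto simp: str_generator prefix_Cons)
  then show ?case using generator str_inj[of i l] rank_le_dim by simp
next
  case (bracket l a b)
  note K = K_bracket[OF bracket.hyps(1,2)] and str_l = str_bracket[OF bracket.hyps(1,2)]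
  have "str i \<noteq> str l" using bracket str_inj[of i l] by auto
  then have p: "prefix (str i) (str a)"
    using bracket.prems str_l by (simp add: prefix_snoc)
  show ?case
  proof (cases "a = i")
    case True
    then show ?thesis using bracket.hyps K by blast
  next
    case False
    from bracket.IH(1)[OF bracket.prems(1) p False] obtain i' b' where
      "i' \<in> {r+1..n}" "K i' = (i, b')" "prefix (str i') (str a)" "i < a" by blast
    then show ?thesis using str_l K(4) by (metis prefixI prefix_order.trans less_trans)
  qed
qed

text \<open>Degrees add under brackets, and each letter counts with its own degree. This yields the
  homogeneity of the generators.\<close>

lemma weight_str: "l \<in> {1..n} \<Longrightarrow> (\<Sum>j=1..n. count_list (str l) j * dg j) = dg l"
proof (induction rule: hall_induct)
  case (generator l)
  have "(\<Sum>j=1..n. count_list (str l) j * dg j) = (\<Sum>j=1..n. if l = j then dg j else 0)"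
    using generator by (intro sum.cong) (auto simp: str_generator)
  then show ?case using generator rank_le_dim by simp
next
  case (bracket l a b)
  note K = K_bracket[OF bracket.hyps(1,2)]
  have "(\<Sum>j=1..n. count_list (str l) j * dg j)
    = (\<Sum>j=1..n. count_list (str a) j * dg j) + (\<Sum>j=1..n. if b = j then dg j else 0)"
    unfolding sum.distrib[symmetric] using bracket.hyps
    by (intro sum.cong) (auto simp: str_bracket algebra_simps)
  then show ?case using bracket.IH K by simp
qed

section \<open>Hall fields on coordinate subspaces\<close>

text \<open>The explicit Grayson-Grossman field attached to an arbitrary basis index. It agrees with
  the corresponding Hall field on the subspace on which sufficiently many coordinates vanish.\<close>

definition E :: "nat \<Rightarrow> vfield" where
  "E i = (\<lambda>x l. if l \<in> {1..n} \<and> prefix (str i) (str l)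
      then signed_monomial n x (drop (length (str i)) (str l)) else 0)"

definition vanish :: "nat \<Rightarrow> (nat \<Rightarrow> real) \<Rightarrow> bool" where
  "vanish k x \<longleftrightarrow> (\<forall>j\<in>{1..k}. x j = 0)"

lemma vanish_0 [simp]: "vanish 0 x" by (simp add: vanish_def)

lemma vanish_zero [simp]: "vanish k (\<lambda>_. 0)" by (simp add: vanish_def)

lemma vanish_upd: "vanish k x \<Longrightarrow> k < q \<Longrightarrow> vanish k (x(q := t))"
  by (simp add: vanish_def)

lemma X_generator_E: "i \<in> {1..r} \<Longrightarrow> X i = E i"
proof (intro ext)
  fix x l assume i: "i \<in> {1..r}"
  have "Iidx r K l = count_list (drop (length (str i)) (str l))"
    using i by (simp add: str_generator Iidx_def fun_eq_iff drop_Suc)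
  then show "X i x l = E i x l"
    using i by (simp add: X_generator genvf_def E_def signed_monomial_altdef)
qed

text \<open>The monomial uses all letters of the string of \<open>l\<close> but the first, and that
  first letter has degree 1.\<close>

lemma homog_E_generator: "i \<in> {1..r} \<Longrightarrow> homog 1 (E i)"
proof -
  assume i: "i \<in> {1..r}"
  have h: "hompoly n dg (int (dg l) - int 1) (\<lambda>x. E i x l)" for l
  proof (cases "l \<in> {1..n} \<and> prefix (str i) (str l)")
    case True
    then obtain ys where ys: "str l = i # ys"
      using i by (auto simp: str_generator prefix_def)
    have "dg l = (\<Sum>j=1..n. (if i = j then dg j else 0) + count_list ys j * dg j)"
      unfolding weight_str[OF conjunct1[OF True], symmetric] ys
      by (intro sum.cong) (auto simp: algebra_simps)
    also have "\<dots> = 1 + (\<Sum>j=1..n. count_list ys j * dg j)"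
      unfolding sum.distrib using i rank_le_dim dg_generator[of i] by simp
    finally have "int (dg l) - int 1 = int (\<Sum>j=1..n. count_list ys j * dg j)"
      by simp
    moreover have "(\<lambda>x. E i x l) = (\<lambda>x. signed_monomial n x ys)"
      using True ys i by (simp add: E_def str_generator)
    ultimately show ?thesis
      using hompoly_signed_monomial[of n dg ys] by simp
  next
    case False
    then have "(\<lambda>x. E i x l) = (\<lambda>x. 0)" by (auto simp: E_def)
    then show ?thesis by (simp add: hompoly_zero)
  qed
  then have "polyfield n (E i)"
    unfolding polyfield_def by (auto intro: hompoly_imp_polyfun) (auto simp: E_def)
  then show ?thesis using h by (simp add: homfield_def)
qed

lemma homog_X: "l \<in> {1..n} \<Longrightarrow> homog (dg l) (X l)"
proof (induction rule: hall_induct)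
  case (generator l)
  then show ?case by (simp only: X_generator_E dg_generator homog_E_generator)
next
  case (bracket l a b)
  then show ?case using K_bracket[of l a b] by (simp add: X_bracket homfield_vf_bracket)
qed

lemma polyfield_X: "l \<in> {1..n} \<Longrightarrow> polyfield n (X l)"
  using homog_X homfield_polyfield by blast

lemma homog_zero: "homog d V \<Longrightarrow> s < d \<Longrightarrow> V = (\<lambda>_ _. 0)"
  by (rule homfield_large_degree[of n dg d]) (auto intro: le_less_trans[OF dg_le_step])

lemma E_nonzero_imp:
  assumes "i \<in> {1..n}" "E i x l \<noteq> 0"
  shows "l \<in> {1..n}" "i \<le> l"
proof -
  show l: "l \<in> {1..n}" using assms by (auto simp: E_def split: if_splits)
  show "i \<le> l"
    using str_prefix_step[OF l assms(1)] assms(2) by (cases "l = i") (auto simp: E_def split: if_splits)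
qed

lemma E_self: "i \<in> {1..n} \<Longrightarrow> E i x i = 1"
  by (simp add: E_def)

lemma suffix_next:
  assumes "i' \<in> {r+1..n}" "K i' = (i, b)" "prefix (str i') (str l)"
  shows "drop (length (str i)) (str l) = b # drop (length (str i')) (str l)"
    and "prefix (str i) (str l)"
  using assms(3) by (auto simp: str_bracket[OF assms(1,2)] prefix_def)

text \<open>A proper extension of the string of \<open>m\<close> continues with a letter
  \<open>b < m\<close>, so its monomial contains the factor \<open>x b = 0\<close>.\<close>

lemma E_on_vanish:
  assumes m: "m \<in> {1..n}" and x: "vanish (m - 1) x"
  shows "E m x l = (if l = m then 1 else 0)"
proof (cases "l \<in> {1..n} \<and> prefix (str m) (str l) \<and> l \<noteq> m")
  case True
  then obtain i' b where i': "i' \<in> {r+1..n}" "K i' = (m, b)" "prefix (str i') (str l)"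
    using str_prefix_step[of l m] m by blast
  have "x b = 0" using x K_bracket[OF i'(1,2)] by (simp add: vanish_def)
  then have "signed_monomial n x (drop (length (str m)) (str l)) = 0"
    unfolding suffix_next(1)[OF i'] using K_bracket(2)[OF i'(1,2)]
    by (intro signed_monomial_eq_0[of b]) auto
  then show ?thesis using True by (simp add: E_def)
next
  case False
  then show ?thesis using m by (auto simp: E_def)
qed

text \<open>The letter \<open>b\<close> following the string of \<open>i\<close> decides. For
  \<open>b = m\<close> differentiation removes it and leaves the monomial of \<open>E i'\<close>;
  for \<open>b < m\<close> the monomial is zero because \<open>x b = 0\<close>; for
  \<open>b > m\<close> sortedness keeps \<open>m\<close> from occurring at all.\<close>

lemma pd_E:
  assumes i': "i' \<in> {r+1..n}" "K i' = (i, m)" and x: "vanish (m - 1) x"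
  shows "pd (\<lambda>y. E i y l) m x = - E i' x l"
proof (cases "l \<in> {1..n} \<and> prefix (str i) (str l)")
  case False
  then have "E i' x l = 0" using suffix_next(2)[OF i'] by (auto simp: E_def)
  moreover have "(\<lambda>y. E i y l) = (\<lambda>_. 0)" using False by (auto simp: E_def)
  ultimately show ?thesis by simp
next
  case True
  note K = K_bracket[OF i']
  show ?thesis
  proof (cases "l = i")
    case True
    then have "(\<lambda>y. E i y l) = (\<lambda>_. 1)" using E_self K(1) by simp
    moreover have "E i' x l = 0" using E_nonzero_imp(2)[of i' x l] i' K(4) True by force
    ultimately show ?thesis by simp
  next
    case False
    then obtain i'' b where i'': "i'' \<in> {r+1..n}" "K i'' = (i, b)" "prefix (str i'') (str l)"
      using str_prefix_step[of l i] K(1) True by blast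
    note suf = suffix_next(1)[OF i''] and K'' = K_bracket[OF i''(1,2)]
    let ?ys = "drop (length (str i'')) (str l)"
    have E: "E i y l = signed_monomial n y (b # ?ys)" for y
      using True by (simp add: E_def suf)
    show ?thesis
    proof (cases "b = m")
      case True
      then have "i'' = i'" using K_inj i' i'' by simp
      then have "E i' x l = signed_monomial n x ?ys"
        using i'' \<open>l \<in> {1..n} \<and> prefix (str i) (str l)\<close> by (simp add: E_def)
      then show ?thesis unfolding E True using pd_signed_monomial_Cons K(2) by simp
    next
      case False
      have "\<not> prefix (str i') (str l)"
      proof
        assume "prefix (str i') (str l)"
        from suffix_next(1)[OF i' this] suf False show False by simp
      qed
      then have E': "E i' x l = 0" by (simp add: E_def)
      consider "b < m" | "m < b" using False by linarith
      then show ?thesis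
      proof cases
        case 1
        then have "x b = 0" using x K''(2) by (simp add: vanish_def)
        then have "E i (x(m := t)) l = 0" for t
          unfolding E using K''(2) 1 by (intro signed_monomial_eq_0[of b]) auto
        then have "pd (\<lambda>y. E i y l) m x = 0" by (intro pd_eqI) simp
        then show ?thesis using E' by simp
      next
        case 2
        \<comment> \<open>The first letter of a string is exempt from sortedness, so the suffix has
          to be exhibited inside the tail.\<close>
        have "b # ?ys = drop (length (str i) - 1) (tl (str l))"
          using suf str_nonempty[OF K(1)] by (cases "str i") (auto simp: drop_Suc)
        then have "sorted (b # ?ys)"
          using sorted_tl_str[of l] True sorted_wrt_drop by metis
        then have "m \<notin> set (b # ?ys)" using 2 by auto
        then show ?thesis unfolding E using pd_signed_monomial_notin E' by simp
      qed
    qed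
  qed
qed

text \<open>The indices of the free generators that remain when \<open>X 1, \<dots>, X k\<close> have been
  removed by Lazard elimination.\<close>

definition elim :: "nat \<Rightarrow> nat set" where
  "elim k = {i \<in> {1..n}. k < i \<and> (i \<le> r \<or> snd (K i) \<le> k)}"

text \<open>If \<open>K m = (a, b)\<close> then \<open>b < a < m\<close>, so \<open>X m\<close> has
  become a free generator by the time it is its turn to be eliminated.\<close>

lemma mem_elim_pred: "m \<in> {1..n} \<Longrightarrow> m \<in> elim (m - 1)"
proof -
  assume m: "m \<in> {1..n}"
  obtain a b where ab: "K m = (a, b)" by fastforce
  show ?thesis
    using m K_bracket[OF _ ab] ab by (cases "m \<le> r") (auto simp: elim_def)
qed

text \<open>In directions \<open>q \<ge> m\<close> one stays in the subspace, where
  \<open>X m\<close> is constant. In directions \<open>q < m\<close> nothing is known about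
  \<open>X m\<close> off the subspace, but there \<open>V\<close> has no component.\<close>

lemma br_on_vanish:
  assumes m: "m \<in> {1..n}"
    and Xm: "\<And>y. vanish (m - 1) y \<Longrightarrow> X m y = E m y"
    and V: "\<And>q. q < m \<Longrightarrow> V x q = 0"
    and x: "vanish (m - 1) x"
  shows "br V (X m) x l = - pd (\<lambda>y. V y l) m x"
proof -
  have 1: "V x q * pd (\<lambda>y. X m y l) q x = 0" for q
  proof (cases "q < m")
    case False
    then have q: "m - 1 < q" using m by auto
    have "X m (x(q := t)) l = (if l = m then 1 else 0)" for t
      using Xm[OF vanish_upd[OF x q]] E_on_vanish[OF m vanish_upd[OF x q]] by simp
    then have "pd (\<lambda>y. X m y l) q x = 0" by (intro pd_eqI) simp
    then show ?thesis by simp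
  qed (simp add: V)
  have "br V (X m) x l = (\<Sum>q=1..n. if q = m then - pd (\<lambda>y. V y l) q x else 0)"
    unfolding vf_bracket_def 1 Xm[OF x] E_on_vanish[OF m x] by (intro sum.cong) auto
  then show ?thesis using m by simp
qed

text \<open>On the subspace where the coordinates before \<open>m\<close> vanish, \<open>X m\<close> is the
  coordinate field, so bracketing with it is differentiation in that coordinate; on the
  explicit fields this extends the string by one letter.\<close>

lemma X_eq_E_vanish_next:
  assumes elim: "\<And>i y. i \<in> elim k \<Longrightarrow> vanish k y \<Longrightarrow> X i y = E i y"
  shows "i \<in> elim (Suc k) \<Longrightarrow> vanish k x \<Longrightarrow> X i x = E i x"
proof (induction i arbitrary: x rule: less_induct)
  case (less i)
  define m where "m = Suc k"
  show ?case
  proof (cases "i \<in> elim k")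
    case True
    then show ?thesis using elim less.prems by simp
  next
    case False
    then have i: "i \<in> {r+1..n}" "snd (K i) = m" "m < i"
      using less.prems by (auto simp: elim_def m_def)
    then obtain a where ab: "K i = (a, m)" by (cases "K i") auto
    note K = K_bracket[OF i(1) ab]
    \<comment> \<open>\<open>X a\<close> may itself be a bracket with \<open>X m\<close>, namely if
      \<open>snd (K a) = m\<close>; hence the inner induction on the index.\<close>
    have "a \<le> r \<or> snd (K a) \<le> m" using K(6) by (meson not_le)
    then have a: "a \<in> elim (Suc k)" using K(1,3) by (simp add: elim_def m_def)
    have Xa: "X a y = E a y" if "vanish k y" for y
      using less.IH[OF K(4) a that] .
    have Xm: "X m y = E m y" if "vanish (m - 1) y" for y
      using elim[of m y] mem_elim_pred[OF K(2)] that by (simp add: m_def)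
    have x: "vanish (m - 1) x" using less.prems by (simp add: m_def)
    have V: "X a x q = 0" if "q < m" for q
      using Xa[OF less.prems(2)] E_nonzero_imp(2)[OF K(1), of x q] that K(3) by force
    show ?thesis
    proof
      fix l
      have "X i x l = - pd (\<lambda>y. X a y l) m x"
        unfolding X_bracket[OF i(1) ab] using K(2) Xm V x by (rule br_on_vanish)
      also have "pd (\<lambda>y. X a y l) m x = pd (\<lambda>y. E a y l) m x"
        unfolding pd_def using Xa[OF vanish_upd[OF less.prems(2)]] by (simp add: m_def)
      also have "\<dots> = - E i x l" using pd_E[OF i(1) ab x] .
      finally show "X i x l = E i x l" by simp
    qed
  qed
qed

lemma X_eq_E_vanish: "i \<in> elim k \<Longrightarrow> vanish k x \<Longrightarrow> X i x = E i x"
proof (induction k arbitrary: i x)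
  case 0
  \<comment> \<open>Second entries of brackets are at least 1, so \<open>elim 0\<close> contains
    only the original generators.\<close>
  have "\<not> r < i"
  proof
    assume "r < i"
    moreover obtain a b where "K i = (a, b)" by fastforce
    ultimately show False using 0 K_bracket(2)[of i a b] by (auto simp: elim_def)
  qed
  then show ?case using 0 by (simp add: elim_def X_generator_E)
next
  case (Suc k)
  then show ?case using X_eq_E_vanish_next[of k i x] by (simp add: vanish_def)
qed

lemma X_coordinate:
  "m \<in> {1..n} \<Longrightarrow> vanish (m - 1) x \<Longrightarrow> X m x l = (if l = m then 1 else 0)"
  using X_eq_E_vanish[OF mem_elim_pred] E_on_vanish by simp

text \<open>It is essential that only \<open>k\<close> coordinates vanish here, one fewer than the
  stage \<open>Suc k\<close> of the generator: left invariance is differentiated along coordinate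
  \<open>Suc k\<close> on that larger subspace.\<close>

lemma X_tangent:
  assumes "i \<in> elim (Suc k)" "vanish k x" "q < i"
  shows "X i x q = 0"
  using X_eq_E_vanish_next[OF X_eq_E_vanish assms(1,2)] E_nonzero_imp(2)[of i x q] assms
  by (force simp: elim_def)

lemma X_at_0: "m \<in> {1..n} \<Longrightarrow> X m (\<lambda>_. 0) l = (if l = m then 1 else 0)"
  by (simp add: X_coordinate)

end

section \<open>Hall rewriting\<close>

lemma foldl_replicate: "foldl f a (replicate p m) = ((\<lambda>V. f V m) ^^ p) a"
  by (induction p arbitrary: a) (simp_all add: funpow_Suc_right del: funpow.simps(2))

context hall
begin

lemma br_sum_X_left:
  "br (\<lambda>x l. \<Sum>k=1..n. c k * X k x l) W = (\<lambda>x l. \<Sum>k=1..n. c k * br (X k) W x l)"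
  by (intro ext vf_bracket_lincomb_left polyfield_X)

lemma br_sum_X_right:
  "br W (\<lambda>x l. \<Sum>k=1..n. c k * X k x l) = (\<lambda>x l. \<Sum>k=1..n. c k * br W (X k) x l)"
  by (intro ext vf_bracket_lincomb_right polyfield_X)

text \<open>A singleton \<open>D\<close> tracks the degree during Hall rewriting;
  \<open>D = UNIV\<close> gives the plain linear span.\<close>

definition span_degrees :: "nat set \<Rightarrow> vfield \<Rightarrow> bool" where
  "span_degrees D V \<longleftrightarrow>
    (\<exists>c. (\<forall>k. dg k \<notin> D \<longrightarrow> c k = 0) \<and> V = (\<lambda>x l. \<Sum>k=1..n. c k * X k x l))"

lemma span_degrees_zero: "span_degrees D (\<lambda>_ _. 0)"
  unfolding span_degrees_def by (rule exI[of _ "\<lambda>_. 0"]) simp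

lemma span_degrees_add:
  assumes "span_degrees D V" "span_degrees D W"
  shows "span_degrees D (\<lambda>x l. V x l + W x l)"
proof -
  obtain c e where "\<forall>k. dg k \<notin> D \<longrightarrow> c k = 0" "V = (\<lambda>x l. \<Sum>k=1..n. c k * X k x l)"
    "\<forall>k. dg k \<notin> D \<longrightarrow> e k = 0" "W = (\<lambda>x l. \<Sum>k=1..n. e k * X k x l)"
    using assms unfolding span_degrees_def by blast
  then show ?thesis
    unfolding span_degrees_def
    by (intro exI[of _ "\<lambda>k. c k + e k"]) (simp add: sum.distrib algebra_simps)
qed

lemma span_degrees_scale:
  assumes "span_degrees D V"
  shows "span_degrees D (\<lambda>x l. a * V x l)"
proof -
  obtain c where "\<forall>k. dg k \<notin> D \<longrightarrow> c k = 0" "V = (\<lambda>x l. \<Sum>k=1..n. c k * X k x l)"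
    using assms unfolding span_degrees_def by blast
  then show ?thesis
    unfolding span_degrees_def
    by (intro exI[of _ "\<lambda>k. a * c k"]) (simp add: sum_distrib_left algebra_simps)
qed

lemma span_degrees_lincomb:
  assumes "\<And>k. k \<in> A \<Longrightarrow> c k \<noteq> 0 \<Longrightarrow> span_degrees D (V k)"
  shows "span_degrees D (\<lambda>x l. \<Sum>k\<in>A. c k * V k x l)"
  using assms
proof (induction A rule: infinite_finite_induct)
  case (insert k A)
  have "span_degrees D (\<lambda>x l. c k * V k x l)"
    using insert.prems by (cases "c k = 0") (auto intro: span_degrees_scale span_degrees_zero)
  then show ?case using insert span_degrees_add by simp
qed (simp_all add: span_degrees_zero)

lemma span_degrees_X: "k \<in> {1..n} \<Longrightarrow> span_degrees {dg k} (X k)"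
proof -
  assume k: "k \<in> {1..n}"
  have "(\<Sum>q=1..n. (if q = k then 1 else 0) * X q x l) = (\<Sum>q=1..n. if q = k then X q x l else 0)" for x l
    by (intro sum.cong) auto
  also have "\<dots> x l = X k x l" for x l using k by simp
  finally show ?thesis
    unfolding span_degrees_def by (intro exI[of _ "\<lambda>q. if q = k then 1 else 0"]) auto
qed

text \<open>Hall's rewriting: a bracket that is not in the basis is expanded by the Jacobi identity
  into brackets of the same total degree whose smaller index is larger.\<close>

lemma span_degrees_br_aux:
  "i \<in> {1..n} \<Longrightarrow> j \<in> {1..n} \<Longrightarrow> dg i + dg j = d \<Longrightarrow> span_degrees {d} (br (X i) (X j))"
proof (induction d arbitrary: i j rule: less_induct)
  case (less d)
  note outer = less.IH
  \<comment> \<open>Antisymmetry reduces any two indices above \<open>m\<close> to an ordered pair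
    whose smaller index is still above \<open>m\<close>.\<close>
  have upgrade: "span_degrees {d} (br (X p) (X q))"
    if "\<And>i j. i \<in> {1..n} \<Longrightarrow> j \<in> {1..n} \<Longrightarrow> dg i + dg j = d \<Longrightarrow> j < i \<Longrightarrow> m < j \<Longrightarrow>
        span_degrees {d} (br (X i) (X j))"
      "p \<in> {1..n}" "q \<in> {1..n}" "dg p + dg q = d" "m < p" "m < q" for m p q
  proof -
    consider "q < p" | "p = q" | "p < q" by linarith
    then show ?thesis
    proof cases
      case 1
      then show ?thesis using that by blast
    next
      case 2
      have "br (X p) (X q) = (\<lambda>_ _. 0)"
        unfolding 2 by (simp add: vf_bracket_lie_deriv fun_eq_iff)
      then show ?thesis by (simp add: span_degrees_zero)
    next
      case 3
      have "dg q + dg p = d" using that(4) by simp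
      then have "span_degrees {d} (br (X q) (X p))"
        using that(1)[OF that(3,2) _ 3 that(5)] by blast
      from span_degrees_scale[OF this, of "-1"] show ?thesis
        by (subst vf_bracket_antisym) simp
    qed
  qed
  have main: "i \<in> {1..n} \<Longrightarrow> j \<in> {1..n} \<Longrightarrow> dg i + dg j = d \<Longrightarrow> j < i \<Longrightarrow>
      span_degrees {d} (br (X i) (X j))" for i j
  proof (induction "n - j" arbitrary: i j rule: less_induct)
    case less
    have later: "span_degrees {d} (br (X p) (X q))"
      if "p \<in> {1..n}" "q \<in> {1..n}" "dg p + dg q = d" "j < p" "j < q" for p q
      by (rule upgrade[of j]) (use less.hyps less.prems that in auto)
    show ?case
    proof (cases "s < d")
      case True
      have "homog d (br (X i) (X j))"
        using homfield_vf_bracket[OF homog_X homog_X] less.prems by blast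
      then show ?thesis using homog_zero True span_degrees_zero by simp
    next
      case False
      show ?thesis
      proof (cases "r < i \<longrightarrow> snd (K i) \<le> j")
        case True
        then obtain l where l: "l \<in> {r+1..n}" "K l = (i, j)"
          using K_complete[of i j] less.prems False by auto
        have "dg l = d" using K_bracket(5)[OF l] less.prems by simp
        then show ?thesis using span_degrees_X[of l] X_bracket[OF l] l(1) by simp
      next
        case False
        then have i: "i \<in> {r+1..n}" using less.prems by simp
        obtain a b where ab: "K i = (a, b)" by fastforce
        note Kb = K_bracket[OF i ab]
        have jb: "j < b" using False ab by simp
        \<comment> \<open>The inner brackets have degree below \<open>d\<close>, so the outer
          induction expands them. Their degree exceeds \<open>dg j\<close>, and \<open>dg\<close> is
          monotone, so every index in the expansion lies beyond \<open>j\<close>, which is what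
          \<open>later\<close> demands.\<close>
        have high: "j < k" if "dg j < dg k" "k \<in> {1..n}" for k
          using dg_mono[of k j] that less.prems(2) by (meson leD leI)
        have "span_degrees {dg a + dg j} (br (X a) (X j))" "span_degrees {dg b + dg j} (br (X b) (X j))"
          using Kb dg_pos[OF Kb(1)] dg_pos[OF Kb(2)] less.prems by (auto intro!: outer)
        then obtain c e where c: "\<forall>k. dg k \<noteq> dg a + dg j \<longrightarrow> c k = 0"
            "br (X a) (X j) = (\<lambda>x l. \<Sum>k=1..n. c k * X k x l)"
          and e: "\<forall>k. dg k \<noteq> dg b + dg j \<longrightarrow> e k = 0"
            "br (X b) (X j) = (\<lambda>x l. \<Sum>k=1..n. e k * X k x l)"
          unfolding span_degrees_def by auto
        have expand: "br (X i) (X j) = (\<lambda>x l. br (br (X a) (X j)) (X b) x l + br (X a) (br (X b) (X j)) x l)"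
          unfolding X_bracket[OF i ab] using Kb less.prems by (intro ext vf_bracket_jacobi polyfield_X)
        have "br (X i) (X j) = (\<lambda>x l. (\<Sum>k=1..n. c k * br (X k) (X b) x l) + (\<Sum>k=1..n. e k * br (X a) (X k) x l))"
          unfolding expand c(2) e(2)
          by (simp only: br_sum_X_left br_sum_X_right)
        moreover have "span_degrees {d} (\<lambda>x l. (\<Sum>k=1..n. c k * br (X k) (X b) x l) + (\<Sum>k=1..n. e k * br (X a) (X k) x l))"
        proof (intro span_degrees_add span_degrees_lincomb)
          fix k assume k: "k \<in> {1..n}" "c k \<noteq> 0"
          then have "dg k = dg a + dg j" using c(1) by metis
          then show "span_degrees {d} (br (X k) (X b))"
            using k Kb less.prems jb dg_pos[OF Kb(1)] high[of k] by (intro later) auto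
        next
          fix k assume k: "k \<in> {1..n}" "e k \<noteq> 0"
          then have "dg k = dg b + dg j" using e(1) by metis
          then show "span_degrees {d} (br (X a) (X k))"
            using k Kb less.prems jb dg_pos[OF Kb(2)] high[of k] by (intro later) auto
        qed
        ultimately show ?thesis by (simp only:)
      qed
    qed
  qed
  show ?case by (rule upgrade[of 0]) (use main less.prems in auto)
qed

abbreviation in_span :: "vfield \<Rightarrow> bool" where
  "in_span \<equiv> span_degrees UNIV"

lemma span_degrees_imp_in_span: "span_degrees D V \<Longrightarrow> in_span V"
  unfolding span_degrees_def by blast

lemma in_span_X: "k \<in> {1..n} \<Longrightarrow> in_span (X k)"
  using span_degrees_X span_degrees_imp_in_span by blast

lemma in_span_br:
  assumes "in_span V" "j \<in> {1..n}"
  shows "in_span (br V (X j))"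
proof -
  obtain c where "V = (\<lambda>x l. \<Sum>k=1..n. c k * X k x l)"
    using assms unfolding span_degrees_def by blast
  then have expand: "br V (X j) = (\<lambda>x l. \<Sum>k=1..n. c k * br (X k) (X j) x l)"
    by (simp only: br_sum_X_left)
  show ?thesis
    unfolding expand
    by (rule span_degrees_lincomb, rule span_degrees_imp_in_span, rule span_degrees_br_aux[OF _ assms(2) refl])
qed

section \<open>Structure constants as values at the origin\<close>

lemma sum_X_at_0: "q \<in> {1..n} \<Longrightarrow> (\<Sum>k=1..n. c k * X k (\<lambda>_. 0) q) = c q"
proof -
  assume "q \<in> {1..n}"
  moreover have "(\<Sum>k=1..n. c k * X k (\<lambda>_. 0) q) = (\<Sum>k=1..n. if q = k then c k else 0)"
    by (intro sum.cong) (auto simp: X_at_0)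
  ultimately show ?thesis by simp
qed

lemma in_span_expansion:
  assumes "in_span V"
  shows "V x l = (\<Sum>k=1..n. V (\<lambda>_. 0) k * X k x l)"
proof -
  obtain c where c: "V = (\<lambda>x l. \<Sum>k=1..n. c k * X k x l)"
    using assms unfolding span_degrees_def by blast
  have "V (\<lambda>_. 0) q = c q" if "q \<in> {1..n}" for q
    unfolding c using sum_X_at_0[OF that] .
  then have "(\<Sum>k=1..n. V (\<lambda>_. 0) k * X k x l) = (\<Sum>k=1..n. c k * X k x l)"
    by (intro sum.cong) simp_all
  then show ?thesis by (simp only: c)
qed

text \<open>Serves both \<open>sc\<close> and \<open>gsc\<close>. At the origin the
  \<open>X k\<close> are the standard basis, so any two admissible coefficient families agree
  there.\<close>

lemma the_coefficients:
  assumes "in_span V"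
  shows "(THE c. (\<forall>k. k \<notin> {1..n} \<longrightarrow> c k = 0) \<and>
      (\<forall>x. \<forall>l\<in>{1..n}. V x l = (\<Sum>k=1..n. c k * X k x l)))
    = (\<lambda>k. if k \<in> {1..n} then V (\<lambda>_. 0) k else 0)"
proof (rule the_equality)
  have "V x l = (\<Sum>k=1..n. V (\<lambda>_. 0) k * X k x l)" for x l
    using assms by (rule in_span_expansion)
  moreover have "(\<Sum>k=1..n. V (\<lambda>_. 0) k * X k x l)
      = (\<Sum>k=1..n. (if k \<in> {1..n} then V (\<lambda>_. 0) k else 0) * X k x l)" for x l
    by (rule sum.cong) simp_all
  ultimately have expand: "V x l = (\<Sum>k=1..n. (if k \<in> {1..n} then V (\<lambda>_. 0) k else 0) * X k x l)" for x l
    by (rule trans)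
  show "(\<forall>k. k \<notin> {1..n} \<longrightarrow> (if k \<in> {1..n} then V (\<lambda>_. 0) k else 0) = 0) \<and>
      (\<forall>x. \<forall>l\<in>{1..n}. V x l = (\<Sum>k=1..n. (if k \<in> {1..n} then V (\<lambda>_. 0) k else 0) * X k x l))"
    by (intro conjI allI impI ballI expand if_not_P)
next
  fix c
  assume c: "(\<forall>k. k \<notin> {1..n} \<longrightarrow> c k = 0) \<and>
      (\<forall>x. \<forall>l\<in>{1..n}. V x l = (\<Sum>k=1..n. c k * X k x l))"
  have "V (\<lambda>_. 0) q = c q" if "q \<in> {1..n}" for q
    using c that sum_X_at_0[OF that] by simp
  then show "c = (\<lambda>k. if k \<in> {1..n} then V (\<lambda>_. 0) k else 0)"
    using c by (auto simp: fun_eq_iff)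
qed

lemma br_eq_sum_sc:
  assumes "i \<in> {1..n}" "j \<in> {1..n}"
  shows "br (X i) (X j) = (\<lambda>x l. \<Sum>k=1..n. sc r n K i j k * X k x l)"
proof -
  have *: "in_span (br (X i) (X j))" using in_span_br in_span_X assms by blast
  have "sc r n K i j k = br (X i) (X j) (\<lambda>_. 0) k" if "k \<in> {1..n}" for k
    unfolding sc_def the_coefficients[OF *] using that by simp
  then have "(\<Sum>k=1..n. sc r n K i j k * X k x l) = (\<Sum>k=1..n. br (X i) (X j) (\<lambda>_. 0) k * X k x l)" for x l
    by (intro sum.cong) simp_all
  with in_span_expansion[OF *] show ?thesis by (intro ext) (rule trans[OF _ sym])
qed

section \<open>Coadjoint action and extremal polynomials\<close>

text \<open>The functional \<open>v\<close> applied to \<open>Y\<close> after the adjoint action of the product of the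
  exponentials of \<open>x m * X m\<close>, for \<open>m\<close> in the given list, the head of the list acting first.
  Nilpotency allows the exponential series to be truncated at \<open>s\<close>.\<close>

primrec coadjoint :: "(nat \<Rightarrow> real) \<Rightarrow> nat list \<Rightarrow> vfield \<Rightarrow> (nat \<Rightarrow> real) \<Rightarrow> real" where
  "coadjoint v [] Y x = (\<Sum>k=1..n. v k * Y (\<lambda>_. 0) k)"
| "coadjoint v (m # ms) Y x
    = (\<Sum>p\<le>s. (- x m) ^ p / fact p * coadjoint v ms (((\<lambda>V. br V (X m)) ^^ p) Y) x)"

lemma coadjoint_upd: "m \<notin> set ms \<Longrightarrow> coadjoint v ms Y (x(m := t)) = coadjoint v ms Y x"
  by (induction ms arbitrary: Y) auto

lemma coadjoint_head_0: "x m = 0 \<Longrightarrow> coadjoint v (m # ms) Y x = coadjoint v ms Y x"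
proof -
  assume "x m = 0"
  then have "coadjoint v (m # ms) Y x = (\<Sum>p\<le>s. if p = 0 then coadjoint v ms Y x else 0)"
    unfolding coadjoint.simps by (intro sum.cong) auto
  then show ?thesis by simp
qed

lemma coadjoint_at_0: "coadjoint v ms Y (\<lambda>_. 0) = (\<Sum>k=1..n. v k * Y (\<lambda>_. 0) k)"
  by (induction ms) (simp_all only: coadjoint_head_0 coadjoint.simps(1))

lemma polyfun_coadjoint: "set ms \<subseteq> {1..n} \<Longrightarrow> polyfun n (coadjoint v ms Y)"
proof (induction ms arbitrary: Y)
  case Nil
  have "coadjoint v [] Y = (\<lambda>_. \<Sum>k=1..n. v k * Y (\<lambda>_. 0) k)" by (simp add: fun_eq_iff)
  then show ?case by (simp add: polyfun_const)
next
  case (Cons m ms)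
  have *: "coadjoint v (m # ms) Y = (\<lambda>x. \<Sum>p\<le>s. 1 / fact p * (- x m) ^ p *
      coadjoint v ms (((\<lambda>V. br V (X m)) ^^ p) Y) x)"
    by (simp add: fun_eq_iff)
  show ?case
    unfolding * using Cons
    by (intro polyfun_sum polyfun_mult polyfun_const polyfun_power polyfun_minus polyfun_var) auto
qed

lemma polyfield_right_br_power:
  "polyfield n Y \<Longrightarrow> m \<in> {1..n} \<Longrightarrow> polyfield n (((\<lambda>V. br V (X m)) ^^ p) Y)"
  by (induction p) (simp_all add: polyfield_vf_bracket polyfield_X)

lemma right_br_power_lincomb:
  assumes "\<And>k. k \<in> A \<Longrightarrow> polyfield n (V k)" "m \<in> {1..n}"
  shows "((\<lambda>V. br V (X m)) ^^ p) (\<lambda>x l. \<Sum>k\<in>A. c k * V k x l)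
    = (\<lambda>x l. \<Sum>k\<in>A. c k * ((\<lambda>V. br V (X m)) ^^ p) (V k) x l)"
proof (induction p)
  case (Suc p)
  have "br (\<lambda>x l. \<Sum>k\<in>A. c k * ((\<lambda>V. br V (X m)) ^^ p) (V k) x l) (X m)
    = (\<lambda>x l. \<Sum>k\<in>A. c k * br (((\<lambda>V. br V (X m)) ^^ p) (V k)) (X m) x l)"
    using assms by (intro ext vf_bracket_lincomb_left polyfield_right_br_power)
  then show ?case by (simp add: Suc.IH)
qed simp

text \<open>Linearity is inherited from the bracket, whose linearity needs differentiable
  components; hence the restriction to \<open>polyfield\<close>.\<close>

lemma coadjoint_lincomb:
  assumes "\<And>k. k \<in> A \<Longrightarrow> polyfield n (V k)" "set ms \<subseteq> {1..n}"
  shows "coadjoint v ms (\<lambda>x l. \<Sum>k\<in>A. c k * V k x l) x = (\<Sum>k\<in>A. c k * coadjoint v ms (V k) x)"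
  using assms
proof (induction ms arbitrary: V)
  case Nil
  show ?case
    by (simp add: sum_distrib_left) (subst sum.swap, simp add: mult.left_commute)
next
  case (Cons m ms)
  have IH: "coadjoint v ms (\<lambda>x l. \<Sum>k\<in>A. c k * ((\<lambda>V. br V (X m)) ^^ p) (V k) x l) x
    = (\<Sum>k\<in>A. c k * coadjoint v ms (((\<lambda>V. br V (X m)) ^^ p) (V k)) x)" for p
    using Cons.prems by (intro Cons.IH polyfield_right_br_power) auto
  have power: "((\<lambda>V. br V (X m)) ^^ p) (\<lambda>x l. \<Sum>k\<in>A. c k * V k x l)
    = (\<lambda>x l. \<Sum>k\<in>A. c k * ((\<lambda>V. br V (X m)) ^^ p) (V k) x l)" for p
    using Cons.prems by (intro right_br_power_lincomb) auto
  show ?case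
    unfolding coadjoint.simps power IH sum_distrib_left
    by (subst sum.swap) (simp add: mult.left_commute)
qed

lemma coadjoint_diff:
  assumes "polyfield n V" "polyfield n W" "set ms \<subseteq> {1..n}"
  shows "coadjoint v ms (\<lambda>x l. V x l - W x l) x = coadjoint v ms V x - coadjoint v ms W x"
  using coadjoint_lincomb[of "{True, False}" "\<lambda>b. if b then V else W" ms v "\<lambda>b. if b then 1 else -1" x] assms
  by simp

lemma coadjoint_minus:
  assumes "polyfield n V" "set ms \<subseteq> {1..n}"
  shows "coadjoint v ms (\<lambda>x l. - V x l) x = - coadjoint v ms V x"
  using coadjoint_lincomb[of "{()}" "\<lambda>_. V" ms v "\<lambda>_. -1" x] assms by simp

lemma coadjoint_zero: "set ms \<subseteq> {1..n} \<Longrightarrow> coadjoint v ms (\<lambda>_ _. 0) x = 0"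
  using coadjoint_lincomb[of "{}" undefined ms v undefined x] by simp

lemma homog_right_br_power:
  "homog e Y \<Longrightarrow> m \<in> {1..n} \<Longrightarrow> homog (e + p * dg m) (((\<lambda>V. br V (X m)) ^^ p) Y)"
proof (induction p)
  case (Suc p)
  from homfield_vf_bracket[OF Suc.IH[OF Suc.prems] homog_X[OF Suc.prems(2)]]
  show ?case by (simp add: add.assoc add.commute[of "dg m"])
qed simp

text \<open>Termwise differentiation shifts the exponential series by one bracket. The truncated sum
  survives the shift because the term with \<open>Suc s\<close> brackets vanishes by homogeneity.
  The minus sign from \<open>- x m\<close> is spent on reversing the bracket.\<close>

lemma pd_coadjoint_head:
  assumes Y: "homog e Y" and m: "m \<in> {1..n}" "m \<notin> set ms" and ms: "set ms \<subseteq> {1..n}"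
  shows "pd (coadjoint v (m # ms) Y) m x = coadjoint v (m # ms) (br (X m) Y) x"
proof -
  define G where "G p = coadjoint v ms (((\<lambda>V. br V (X m)) ^^ p) Y) x" for p
  define d where "d p = (case p of 0 \<Rightarrow> 0 | Suc q \<Rightarrow> - ((- x m) ^ q / fact q * G (Suc q)))" for p
  have "s < e + Suc s * dg m" using dg_pos[OF m(1)] by (cases "dg m") auto
  then have "((\<lambda>V. br V (X m)) ^^ Suc s) Y = (\<lambda>_ _. 0)"
    using homog_zero[OF homog_right_br_power[OF Y m(1)]] by blast
  then have top: "d (Suc s) = 0"
    unfolding d_def G_def by (simp add: coadjoint_zero[OF ms])
  have *: "coadjoint v (m # ms) Y (x(m := t)) = (\<Sum>p\<le>s. (- t) ^ p / fact p * G p)" for t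
    unfolding coadjoint.simps coadjoint_upd[OF m(2)] G_def by simp
  have "((\<lambda>t. (- t) ^ p / fact p * G p) has_real_derivative d p) (at (x m))" for p
  proof (cases p)
    case (Suc q)
    have "((\<lambda>t. (- t) ^ Suc q / fact (Suc q) * G p) has_real_derivative
        real (Suc q) * (- x m) ^ q * (-1) / fact (Suc q) * G p) (at (x m))"
      by (rule derivative_eq_intros refl | simp)+
    also have "real (Suc q) * (- x m) ^ q * (-1) / fact (Suc q) * G p = d p"
      unfolding d_def fact_Suc Suc by (simp add: field_simps del: of_nat_Suc)
    finally show ?thesis using Suc by simp
  qed (simp add: d_def)
  then have "pd (coadjoint v (m # ms) Y) m x = (\<Sum>p\<le>s. d p)"
    unfolding pd_def * by (intro DERIV_imp_deriv DERIV_sum) auto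
  also have "\<dots> = (\<Sum>p\<le>Suc s. d p)" using top by simp
  also have "\<dots> = (\<Sum>q\<le>s. - ((- x m) ^ q / fact q * G (Suc q)))"
    by (subst sum.atMost_Suc_shift) (simp add: d_def)
  also have "\<dots> = - coadjoint v (m # ms) (br Y (X m)) x"
    by (simp add: sum_negf G_def funpow_Suc_right del: funpow.simps(2))
  also have "\<dots> = coadjoint v (m # ms) (br (X m) Y) x"
    using Y m(1) ms
    by (subst vf_bracket_antisym[of n "X m"], subst coadjoint_minus)
      (simp_all add: polyfield_vf_bracket polyfield_X homfield_polyfield)
  finally show ?thesis .
qed


text \<open>Membership in \<open>elim m\<close> is precisely the Hall condition for bracketing with
  \<open>X m\<close>. Unless the degree exceeds \<open>s\<close>, the bracket is thus a basis
  element with second entry \<open>m\<close>, again a generator at this stage.\<close>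

lemma br_elim_cases:
  assumes m: "m \<in> {1..n}" and i: "i \<in> elim m"
  obtains "br (X i) (X m) = (\<lambda>_ _. 0)"
  | i' where "i' \<in> elim m" "dg i' = dg i + dg m" "br (X i) (X m) = X i'"
proof (cases "s < dg i + dg m")
  case True
  have "homog (dg i + dg m) (br (X i) (X m))"
    using m i by (intro homfield_vf_bracket homog_X) (auto simp: elim_def)
  then show thesis using homog_zero True that(1) by blast
next
  case False
  obtain l where l: "l \<in> {r+1..n}" "K l = (i, m)"
    by (rule K_complete[of i m]) (use m i False in \<open>auto simp: elim_def\<close>)
  have "l \<in> elim m" using l K_bracket[OF l] by (auto simp: elim_def)
  then show thesis using that(2) K_bracket[OF l] X_bracket[OF l] by simp
qed

lemma lie_deriv_X_coordinate:
  assumes "m \<in> {1..n}" "vanish (m - 1) x"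
  shows "lie_deriv n (X m) f x = pd f m x"
proof -
  have "lie_deriv n (X m) f x = (\<Sum>q=1..n. if q = m then pd f q x else 0)"
    unfolding lie_deriv_def using assms by (intro sum.cong) (auto simp: X_coordinate)
  then show ?thesis using assms by simp
qed

lemma lie_deriv_zero_field [simp]: "lie_deriv n (\<lambda>_ _. 0) f x = 0"
  by (simp add: lie_deriv_def)

lemma br_zero_left [simp]: "br (\<lambda>_ _. 0) V = (\<lambda>_ _. 0)"
  by (simp add: vf_bracket_def fun_eq_iff)

lemma br_zero_right [simp]: "br V (\<lambda>_ _. 0) = (\<lambda>_ _. 0)"
  by (simp add: vf_bracket_def fun_eq_iff)

text \<open>Left invariance of the generators, proved by Lazard elimination: it is enough to compare the
  derivatives of both sides in the coordinate \<open>m\<close>, and these are again differences of the same kind,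
  but of larger degree.\<close>

lemma coadjoint_left_invariant_step:
  fixes v :: "nat \<Rightarrow> real"
  assumes m: "m \<in> {1..n}" and ms: "set ms \<subseteq> {1..n}" "m \<notin> set ms"
    and later: "\<And>i e Y x. i \<in> elim m \<Longrightarrow> homog e Y \<Longrightarrow> vanish m x \<Longrightarrow>
      coadjoint v ms (br (X i) Y) x = lie_deriv n (X i) (coadjoint v ms Y) x"
  shows "i \<in> elim m \<Longrightarrow> homog e Y \<Longrightarrow> vanish (m - 1) x \<Longrightarrow>
      coadjoint v (m # ms) (br (X i) Y) x = lie_deriv n (X i) (coadjoint v (m # ms) Y) x"
\<comment> \<open>Each recursive call raises either the degree \<open>e\<close> of \<open>Y\<close>,
  where \<open>Y\<close> is zero once \<open>e > s\<close>, or the degree of \<open>X i\<close>,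
  which is at most \<open>s\<close>.\<close>
proof (induction "(s + 1 - e) + (s - dg i)" arbitrary: i e Y x rule: less_induct)
  case less
  let ?C = "coadjoint v (m # ms)"
  have mms: "set (m # ms) \<subseteq> {1..n}" using m ms by simp
  note i = less.prems(1) and Y = less.prems(2)
  have i_n: "i \<in> {1..n}" and mi: "m < i" using i by (auto simp: elim_def)
  note PX = polyfield_X[OF i_n] polyfield_X[OF m] and PY = homfield_polyfield[OF Y]
  note PB = polyfield_vf_bracket[OF PX(1) PY] polyfield_vf_bracket[OF PX(2) PY] polyfield_vf_bracket[OF PX]
  show ?case
  proof (cases "s < e")
    case True
    then have Y0: "Y = (\<lambda>_ _. 0)" using homog_zero Y by blast
    have C0: "?C (\<lambda>_ _. 0) = (\<lambda>_. 0)"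
      using coadjoint_zero[OF mms] by blast
    show ?thesis unfolding Y0 br_zero_right C0 by (simp add: lie_deriv_def)
  next
    case False
    define G where "G y = ?C (br (X i) Y) y - lie_deriv n (X i) (?C Y) y" for y
    have PC: "polyfun n (?C Z)" for Z by (rule polyfun_coadjoint[OF mms])
    have PL: "polyfun n (lie_deriv n (X i) (?C Z))" for Z by (rule polyfun_lie_deriv[OF PX(1) PC])
    have PG: "polyfun n G" unfolding G_def by (rule polyfun_diff[OF PC PL])
    have k: "Suc (m - 1) = m" using m by simp
    have pd0: "pd G m y = 0" if y: "vanish (m - 1) y" for y
    proof -
      have XY: "homog (dg i + e) (br (X i) Y)" and mY: "homog (dg m + e) (br (X m) Y)"
        using homfield_vf_bracket[OF homog_X Y] i_n m by blast+
      have comm: "br (X m) (br (X i) Y) = (\<lambda>x l. br (X i) (br (X m) Y) x l - br (br (X i) (X m)) Y x l)"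
        using vf_bracket_jacobi[OF PX PY] vf_bracket_antisym[of n "br (X i) Y" "X m"]
        by (simp add: fun_eq_iff)
      have 1: "pd (?C (br (X i) Y)) m y = ?C (br (X i) (br (X m) Y)) y - ?C (br (br (X i) (X m)) Y) y"
        unfolding pd_coadjoint_head[OF XY m ms(2,1)] comm
        by (rule coadjoint_diff[OF _ _ mms]) (intro polyfield_vf_bracket PX PY)+
      have pdC: "pd (?C Y) m = ?C (br (X m) Y)"
        by (rule ext) (rule pd_coadjoint_head[OF Y m ms(2,1)])
      \<comment> \<open>Exchanging the derivatives lets \<open>x m\<close> act first, where it is a
        bracket with \<open>X m\<close>; \<open>pdC\<close> holds on all of R^n, so it may be
        differentiated in any direction \<open>q\<close>.\<close>
      have pdd: "pd (pd (?C Y) q) m y = pd (?C (br (X m) Y)) q y" for q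
        using pd_commute[OF PC[of Y], of q m y] unfolding pdC .
      have pdX: "pd (\<lambda>y. X i y q) m y = - br (X i) (X m) y q" for q
        using br_on_vanish[of m "X i" y q, OF m X_eq_E_vanish[OF mem_elim_pred[OF m]] _ y]
          X_tangent[of i "m - 1" y] i y mi k by simp
      have "pd (lie_deriv n (X i) (?C Y)) m y
        = (\<Sum>q=1..n. pd (\<lambda>y. X i y q) m y * pd (?C Y) q y + X i y q * pd (pd (?C Y) q) m y)"
        unfolding lie_deriv_def
        by (subst pd_sum[of _ n])
          (simp_all only: pd_mult[OF polyfield_comp[OF PX(1)] polyfun_pd[OF PC]]
            polyfun_mult[OF polyfield_comp[OF PX(1)] polyfun_pd[OF PC]])
      also have "\<dots> = lie_deriv n (X i) (?C (br (X m) Y)) y - lie_deriv n (br (X i) (X m)) (?C Y) y"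
        unfolding pdd pdX lie_deriv_def
        by (simp add: sum.distrib sum_subtractf del: coadjoint.simps)
      finally have "pd G m y = (?C (br (X i) (br (X m) Y)) y - lie_deriv n (X i) (?C (br (X m) Y)) y)
          - (?C (br (br (X i) (X m)) Y) y - lie_deriv n (br (X i) (X m)) (?C Y) y)"
        unfolding G_def pd_diff[OF PC PL] 1 by simp
      moreover have "?C (br (X i) (br (X m) Y)) y = lie_deriv n (X i) (?C (br (X m) Y)) y"
        using less.hyps[OF _ i mY y] dg_pos[OF m] False by simp
      moreover have "?C (br (br (X i) (X m)) Y) y = lie_deriv n (br (X i) (X m)) (?C Y) y"
      proof (cases rule: br_elim_cases[OF m i])
        case 1
        then show ?thesis using coadjoint_zero[OF mms] by (simp del: coadjoint.simps)
      next
        case (2 i')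
        have "i' \<in> {1..n}" using 2 by (simp add: elim_def)
        then show ?thesis
          using less.hyps[OF _ 2(1) Y y] dg_pos[OF m] dg_le_step[of i'] False 2 by simp
      qed
      ultimately show ?thesis by simp
    qed
    have "((\<lambda>t. G (x(m := t))) has_real_derivative 0) (at t)" for t
      using polyfun_has_derivative[OF PG, of "x(m := t)" m] pd0[of "x(m := t)"]
        less.prems(3) m by (simp add: vanish_upd)
    then have "G (x(m := x m)) = G (x(m := 0))"
      using DERIV_isconst_all[of "\<lambda>t. G (x(m := t))"] by blast
    moreover have "G (x(m := 0)) = 0"
    proof -
      define y where "y = x(m := 0)"
      have ym: "y m = 0" by (simp add: y_def)
      have y: "vanish m y" "vanish (m - 1) y"
        using less.prems(3) by (auto simp: y_def vanish_def)
      \<comment> \<open>Moving in a direction \<open>q > m\<close> keeps coordinate \<open>m\<close>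
        at zero, so the exponential of \<open>X m\<close> stays trivial; in directions
        \<open>q \<le> m\<close> the field has no component.\<close>
      have "X i y q * pd (?C Y) q y = X i y q * pd (coadjoint v ms Y) q y" for q
      proof (cases "q \<le> m")
        case True
        then have "X i y q = 0" using X_tangent[of i "m - 1" y q] i y mi k by simp
        then show ?thesis by simp
      next
        case False
        then have "?C Y (y(q := t)) = coadjoint v ms Y (y(q := t))" for t
          by (intro coadjoint_head_0) (simp add: ym)
        then show ?thesis by (simp only: pd_def)
      qed
      then have "lie_deriv n (X i) (?C Y) y = lie_deriv n (X i) (coadjoint v ms Y) y"
        unfolding lie_deriv_def by (rule sum.cong[OF refl])
      moreover have "?C Z y = coadjoint v ms Z y" for Z
        using ym by (rule coadjoint_head_0)
      ultimately show ?thesis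
        unfolding G_def y_def[symmetric] using later[OF i Y y(1)] by (simp del: coadjoint.simps)
    qed
    ultimately show ?thesis by (simp add: G_def del: coadjoint.simps)
  qed
qed

text \<open>At \<open>k = n\<close> no generator is left. Passing from \<open>Suc k\<close> to
  \<open>k\<close>, every generator other than \<open>X (Suc k)\<close> is already in
  \<open>elim (Suc k)\<close>; \<open>X (Suc k)\<close> itself acts as the coordinate derivative,
  and the claim is then \<open>pd_coadjoint_head\<close>.\<close>

lemma coadjoint_left_invariant:
  assumes "k \<le> n"
  shows "i \<in> elim k \<Longrightarrow> homog e Y \<Longrightarrow> vanish k x \<Longrightarrow>
    coadjoint v [Suc k..<Suc n] (br (X i) Y) x = lie_deriv n (X i) (coadjoint v [Suc k..<Suc n] Y) x"
  using assms
proof (induction k arbitrary: i e Y x rule: inc_induct)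
  case base
  then show ?case by (auto simp: elim_def)
next
  case (step k)
  define m where "m = Suc k"
  define ms where "ms = [Suc m..<Suc n]"
  have m: "m \<in> {1..n}" and ms: "set ms \<subseteq> {1..n}" "m \<notin> set ms"
    using step.hyps by (auto simp: m_def ms_def)
  have list: "[Suc k..<Suc n] = m # ms"
    unfolding m_def ms_def using step.hyps by (subst upt_conv_Cons) auto
  have vm: "vanish (m - 1) x" using step.prems by (simp add: m_def)
  show ?case
  proof (cases "i = m")
    case True
    show ?thesis
      unfolding list True lie_deriv_X_coordinate[OF m vm] pd_coadjoint_head[OF step.prems(2) m ms(2,1)] ..
  next
    case False
    then have "i \<in> elim m" using step.prems(1) by (auto simp: elim_def m_def)
    from coadjoint_left_invariant_step[OF m ms step.IH[folded m_def, folded ms_def] this step.prems(2) vm]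
    show ?thesis unfolding list .
  qed
qed

section \<open>Expansion over multi-indices\<close>

definition box :: "nat list \<Rightarrow> (nat \<Rightarrow> nat) set" where
  "box ms = {\<alpha>. (\<forall>j. j \<notin> set ms \<longrightarrow> \<alpha> j = 0) \<and> (\<forall>j. \<alpha> j \<le> s)}"

lemma box_Cons:
  assumes "m \<notin> set ms"
  shows "bij_betw (\<lambda>(p, \<beta>). \<beta>(m := p)) ({..s} \<times> box ms) (box (m # ms))"
  by (rule bij_betw_byWitness[where f' = "\<lambda>\<alpha>. (\<alpha> m, \<alpha>(m := 0))"])
    (use assms in \<open>auto simp: box_def\<close>)

lemma finite_box: "distinct ms \<Longrightarrow> finite (box ms)"
proof (induction ms)
  case Nil
  have "box [] = {\<lambda>_. 0}" by (auto simp: box_def)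
  then show ?case by simp
next
  case (Cons m ms)
  then show ?case using bij_betw_finite[OF box_Cons[of m ms]] by simp
qed

text \<open>The truncated exponentials are multiplied out, each exponent running independently up to
  \<open>s\<close>. The head of the list brackets first, which for an increasing list is the order
  of \<open>alist\<close>.\<close>

lemma coadjoint_multiindex:
  "distinct ms \<Longrightarrow> coadjoint v ms Y x
    = (\<Sum>\<alpha>\<in>box ms. (\<Prod>j\<in>set ms. (- x j) ^ \<alpha> j / fact (\<alpha> j)) *
        (\<Sum>k=1..n. v k * foldl (\<lambda>V j. br V (X j)) Y (concat (map (\<lambda>j. replicate (\<alpha> j) j) ms)) (\<lambda>_. 0) k))"
proof (induction ms arbitrary: Y)
  case Nil
  have "box [] = {\<lambda>_. 0}" by (auto simp: box_def)
  then show ?case by simp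
next
  case (Cons m ms)
  have m: "m \<notin> set ms" using Cons.prems by simp
  define H where "H ms Y \<alpha> = (\<Prod>j\<in>set ms. (- x j) ^ \<alpha> j / fact (\<alpha> j)) *
    (\<Sum>k=1..n. v k * foldl (\<lambda>V j. br V (X j)) Y (concat (map (\<lambda>j. replicate (\<alpha> j) j) ms)) (\<lambda>_. 0) k)"
    for ms Y \<alpha>
  have H: "H (m # ms) Y (\<beta>(m := p)) = (- x m) ^ p / fact p * H ms (((\<lambda>V. br V (X m)) ^^ p) Y) \<beta>" for p \<beta>
  proof -
    have "map (\<lambda>j. replicate ((\<beta>(m := p)) j) j) ms = map (\<lambda>j. replicate (\<beta> j) j) ms"
      using m by auto
    moreover have "(\<Prod>j\<in>set ms. (- x j) ^ (\<beta>(m := p)) j / fact ((\<beta>(m := p)) j))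
        = (\<Prod>j\<in>set ms. (- x j) ^ \<beta> j / fact (\<beta> j))"
      using m by (intro prod.cong) auto
    ultimately show ?thesis
      unfolding H_def using m by (simp add: foldl_replicate del: map_eq_conv)
  qed
  have "coadjoint v (m # ms) Y x = (\<Sum>p\<le>s. \<Sum>\<beta>\<in>box ms. H (m # ms) Y (\<beta>(m := p)))"
    unfolding coadjoint.simps H using Cons by (simp add: H_def sum_distrib_left)
  also have "\<dots> = (\<Sum>(p, \<beta>)\<in>{..s} \<times> box ms. H (m # ms) Y (\<beta>(m := p)))"
    by (rule sum.cartesian_product)
  also have "\<dots> = (\<Sum>\<alpha>\<in>box (m # ms). H (m # ms) Y \<alpha>)"
    using sum.reindex_bij_betw[OF box_Cons[OF m], of "H (m # ms) Y"] by (simp add: case_prod_unfold)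
  finally show ?case by (simp only: H_def)
qed

lemma in_span_foldl_br:
  "in_span Y \<Longrightarrow> set ys \<subseteq> {1..n} \<Longrightarrow> in_span (foldl (\<lambda>V j. br V (X j)) Y ys)"
  by (induction ys arbitrary: Y) (simp_all add: in_span_br)

lemma homog_foldl_br:
  "homog e Y \<Longrightarrow> set ys \<subseteq> {1..n} \<Longrightarrow>
    homog (e + sum_list (map dg ys)) (foldl (\<lambda>V j. br V (X j)) Y ys)"
proof (induction ys arbitrary: e Y)
  case (Cons j ys)
  have "homog (e + dg j) (br Y (X j))"
    using Cons.prems homog_X by (intro homfield_vf_bracket) auto
  from Cons.IH[OF this] Cons.prems show ?case by (simp add: add.assoc)
qed simp

lemma set_alist: "set (alist n \<alpha>) \<subseteq> {1..n}"
  by (auto simp: alist_def)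

lemma gsc_eq:
  assumes "i \<in> {1..n}" "k \<in> {1..n}"
  shows "gsc r n K i \<alpha> k = gbr r n K i \<alpha> (\<lambda>_. 0) k"
proof -
  have "in_span (gbr r n K i \<alpha>)"
    unfolding gbr_def using in_span_X assms(1) set_alist by (intro in_span_foldl_br)
  from the_coefficients[OF this] show ?thesis
    unfolding gsc_def using assms(2) by simp
qed

text \<open>Every letter has degree at least 1, so more than \<open>s\<close> letters push the
  degree beyond \<open>s\<close>.\<close>

lemma gbr_large:
  assumes "i \<in> {1..n}" "\<alpha> \<in> midx n" "s < \<alpha> j"
  shows "gbr r n K i \<alpha> = (\<lambda>_ _. 0)"
proof -
  have j: "j \<in> {1..n}" using assms(2,3) by (auto simp: midx_def)
  have "s < \<alpha> j" by fact
  also have "\<alpha> j \<le> sum_list (map \<alpha> [1..<Suc n])"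
    using j by (intro member_le_sum_list) (auto simp del: upt_Suc)
  also have "\<dots> = length (alist n \<alpha>)"
    by (simp add: alist_def length_concat comp_def)
  also have "\<dots> = sum_list (map (\<lambda>_. 1) (alist n \<alpha>))"
    by (simp add: sum_list_triv)
  also have "\<dots> \<le> sum_list (map dg (alist n \<alpha>))"
    using set_alist dg_pos by (intro sum_list_mono) blast
  finally have "s < dg i + sum_list (map dg (alist n \<alpha>))" by simp
  then show ?thesis
    unfolding gbr_def using homog_zero[OF homog_foldl_br[OF homog_X[OF assms(1)] set_alist]] by blast
qed

text \<open>Multi-indices outside \<open>box\<close> contribute zero, which turns
  \<open>infsum\<close> into a finite sum. On \<open>box\<close> the coefficients \<open>gsc\<close>
  are components of nested brackets at the origin, exactly what \<open>coadjoint\<close> pairs with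
  \<open>v\<close>.\<close>

lemma Pext_eq_coadjoint:
  assumes i: "i \<in> {1..n}"
  shows "Pext r n K v i = coadjoint v [1..<Suc n] (X i)"
proof
  fix x
  define T where "T \<alpha> = (-1) ^ mabs n \<alpha> / mfact n \<alpha> *
       (\<Sum>k=1..n. gsc r n K i \<alpha> k * v k) * mpow n x \<alpha>" for \<alpha>
  have box: "box [1..<Suc n] = {\<alpha> \<in> midx n. \<forall>j. \<alpha> j \<le> s}"
    by (auto simp: box_def midx_def)
  have zero: "T \<alpha> = 0" if "\<alpha> \<in> midx n - box [1..<Suc n]" for \<alpha>
  proof -
    obtain j where "s < \<alpha> j"
      using \<open>\<alpha> \<in> midx n - box [1..<Suc n]\<close> unfolding box by (auto simp: not_le)
    then have "gsc r n K i \<alpha> k = 0" if "k \<in> {1..n}" for k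
      using gbr_large[OF i, of \<alpha> j] gsc_eq[OF i that] \<open>\<alpha> \<in> midx n - box [1..<Suc n]\<close> by simp
    then show ?thesis by (simp add: T_def)
  qed
  have "Pext r n K v i x = infsum T (midx n)"
    unfolding Pext_def T_def ..
  also have "\<dots> = infsum T (box [1..<Suc n])"
  proof (rule infsum_cong_neutral)
    show "T \<alpha> = 0" if "\<alpha> \<in> box [1..<Suc n] - midx n" for \<alpha>
      using that unfolding box by blast
  qed (use zero in auto)
  also have "\<dots> = sum T (box [1..<Suc n])"
    by (simp add: finite_box)
  also have "\<dots> = coadjoint v [1..<Suc n] (X i) x"
    unfolding coadjoint_multiindex[OF distinct_upt]
  proof (rule sum.cong[OF refl])
    fix \<alpha>
    have "(\<Prod>j\<in>set [1..<Suc n]. (- x j) ^ \<alpha> j / fact (\<alpha> j))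
        = (-1) ^ mabs n \<alpha> / mfact n \<alpha> * mpow n x \<alpha>"
    proof -
      have "(- x j) ^ c = (-1) ^ c * x j ^ c" for j c
        by (rule power_minus)
      moreover have "set [1..<Suc n] = {1..n}" by auto
      ultimately show ?thesis
        by (simp only: mabs_def mfact_def mpow_def power_sum prod_dividef prod.distrib) simp
    qed
    moreover have "(\<Sum>k=1..n. gsc r n K i \<alpha> k * v k) = (\<Sum>k=1..n. v k * gbr r n K i \<alpha> (\<lambda>_. 0) k)"
      using i by (intro sum.cong) (simp_all add: gsc_eq)
    ultimately show "T \<alpha> = (\<Prod>j\<in>set [1..<Suc n]. (- x j) ^ \<alpha> j / fact (\<alpha> j)) *
        (\<Sum>k=1..n. v k * foldl (\<lambda>V j. br V (X j)) (X i)
          (concat (map (\<lambda>j. replicate (\<alpha> j) j) [1..<Suc n])) (\<lambda>_. 0) k)"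
      unfolding T_def gbr_def alist_def by simp
  qed
  finally show "Pext r n K v i x = coadjoint v [1..<Suc n] (X i) x" .
qed

lemma polyfun_Pext: "i \<in> {1..n} \<Longrightarrow> polyfun n (Pext r n K v i)"
  unfolding Pext_eq_coadjoint by (rule polyfun_coadjoint) auto

lemma Pext_at_0: "i \<in> {1..n} \<Longrightarrow> Pext r n K v i (\<lambda>_. 0) = v i"
proof -
  assume i: "i \<in> {1..n}"
  have "(\<Sum>k=1..n. v k * X i (\<lambda>_. 0) k) = (\<Sum>k=1..n. if k = i then v k else 0)"
    using i by (intro sum.cong) (auto simp: X_at_0)
  then show ?thesis unfolding Pext_eq_coadjoint[OF i] coadjoint_at_0 using i by simp
qed

text \<open>The generators lie in \<open>elim 0\<close>, where left invariance holds at every point.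
  The sign comes from reversing the bracket of \<open>X j\<close> and \<open>X i\<close>.\<close>

lemma lie_deriv_Pext:
  assumes i: "i \<in> {1..n}" and j: "j \<in> {1..r}"
  shows "lie_deriv n (X j) (Pext r n K v i) x = - (\<Sum>k=1..n. sc r n K i j k * Pext r n K v k x)"
proof -
  let ?C = "coadjoint v [1..<Suc n]"
  have jn: "j \<in> {1..n}" using j rank_le_dim by simp
  have ms: "set [1..<Suc n] \<subseteq> {1..n}" by auto
  have "j \<in> elim 0" using j rank_le_dim by (simp add: elim_def)
  from coadjoint_left_invariant[OF _ this homog_X[OF i], of x v]
  have "lie_deriv n (X j) (?C (X i)) x = ?C (br (X j) (X i)) x"
    by simp
  also have "\<dots> = - ?C (br (X i) (X j)) x"
    unfolding vf_bracket_antisym[of n "X j"]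
    by (rule coadjoint_minus[OF polyfield_vf_bracket[OF polyfield_X[OF i] polyfield_X[OF jn]] ms])
  also have "?C (br (X i) (X j)) x = (\<Sum>k=1..n. sc r n K i j k * ?C (X k) x)"
    unfolding br_eq_sum_sc[OF i jn] by (rule coadjoint_lincomb[OF polyfield_X ms])
  also have "\<dots> = (\<Sum>k=1..n. sc r n K i j k * Pext r n K v k x)"
    by (intro sum.cong) (simp_all only: Pext_eq_coadjoint)
  finally show ?thesis by (simp only: Pext_eq_coadjoint[OF i])
qed

end

section \<open>Lipschitz solutions of linear equations\<close>

text \<open>A Lipschitz function cannot increase on a null set: cover the null set by an open set of
  small measure and compare the function with the measure of that cover.\<close>

lemma lipschitz_ae_nonpos_derivative_imp_le:
  fixes f :: "real \<Rightarrow> real"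
  assumes lip: "L-lipschitz_on {0..1} f"
    and ae: "AE t in lborel. t \<in> {0..1} \<longrightarrow> (\<exists>D\<le>0. (f has_real_derivative D) (at t))"
    and b: "b \<in> {0..1}"
  shows "f b \<le> f 0"
proof (rule field_le_epsilon)
  fix e :: real assume e: "0 < e"
  have L0: "0 \<le> L" using lip by (rule lipschitz_on_nonneg)
  have L: "f t - f u \<le> L * (t - u)" if "u \<in> {0..1}" "t \<in> {0..1}" "u \<le> t" for u t
    using lipschitz_onD[OF lip that(2,1)] that(3) by (simp add: dist_real_def)
  \<comment> \<open>The error \<open>e\<close> is divided into \<open>L * d\<close> for the cover of
    the null set and \<open>d\<close> for a slope of size \<open>d\<close> over the unit
    interval.\<close>
  define d where "d = e / (L + 1)"
  have d: "0 < d" "(L + 1) * d = e" using e L0 by (simp_all add: d_def)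
  obtain N where N: "{t \<in> space lborel. \<not> (t \<in> {0..1} \<longrightarrow> (\<exists>D\<le>0. (f has_real_derivative D) (at t)))} \<subseteq> N"
      "emeasure lborel N = 0" "N \<in> sets lborel"
    using AE_E[OF ae] by blast
  obtain U where U: "open U" "N \<subseteq> U" "emeasure lborel (U - N) < ennreal d"
    using outer_regular_lborel[of N d] N(3) d(1) by auto
  have Us: "U \<in> sets lborel" using U(1) by simp
  have "emeasure lborel U \<le> emeasure lborel (U - N) + emeasure lborel N"
    using emeasure_subadditive[of "U - N" lborel N] U(2) N(3) Us by (simp add: Un_absorb2)
  then have Ud: "emeasure lborel U < ennreal d" using N(2) U(3) by simp
  then have Uf: "U \<in> fmeasurable lborel"
    using Us by (intro fmeasurableI) (auto intro: order.strict_trans)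
  define g where "g t = measure lborel (U \<inter> {0..t})" for t
  have gf: "U \<inter> {0..t} \<in> fmeasurable lborel" for t :: real
    using Uf by (rule fmeasurableI2) (use Us in auto)
  have g_mono: "g t \<le> g u" if "t \<le> u" for t u
    unfolding g_def using gf U(1) that by (intro measure_mono_fmeasurable) auto
  have "measure lborel U < d"
    using Ud d(1) Uf by (simp add: emeasure_eq_measure2 ennreal_less_iff)
  then have g_le: "g t \<le> d" for t
    using measure_mono_fmeasurable[of "U \<inter> {0..t}" U lborel] Uf gf[of t] fmeasurableD
    unfolding g_def by fastforce
  have g_nonneg: "0 \<le> g t" for t by (simp add: g_def)
  have g_grow: "g t + (u - t) \<le> g u" if "0 \<le> t" "t \<le> u" "{t..u} \<subseteq> U" for t u
  proof -
    have "g t + measure lborel {t<..u} = measure lborel (U \<inter> {0..t} \<union> {t<..u})"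
    proof -
      have "U \<inter> {0..t} \<inter> {t<..u} = {}" by auto
      moreover have "{t<..u} \<in> fmeasurable lborel"
        by (rule fmeasurableI2[OF Uf]) (use that(3) in auto)
      ultimately show ?thesis using measure_Un3[OF gf[of t], of "{t<..u}"] by (simp add: g_def)
    qed
    also have "\<dots> \<le> g u"
      unfolding g_def using gf that fmeasurableD[OF gf[of t]]
      by (intro measure_mono_fmeasurable) auto
    finally show ?thesis using that by simp
  qed
  \<comment> \<open>Inside \<open>U\<close> the growth of \<open>f\<close> is at most
    \<open>L\<close> times that of \<open>g\<close>; outside \<open>U\<close> the derivative is
    nonpositive and the slope \<open>d\<close> absorbs the remainder of the difference quotient. So
    \<open>h\<close> is locally nonincreasing to the right in both cases.\<close>
  define h where "h t = f t - L * g t - d * t" for t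
  have h_lip: "h u \<le> h t + L * (u - t)" if "t \<in> {0..1}" "u \<in> {0..1}" "t \<le> u" for t u
    using L[OF that] mult_left_mono[OF g_mono[OF that(3)] L0] mult_left_mono[of t u d] that(3) d(1)
    unfolding h_def by linarith
  have local: "\<exists>\<delta>>0. \<forall>u\<in>{0..1}. t < u \<and> u < t + \<delta> \<longrightarrow> h u \<le> h t" if t: "t \<in> {0..1}" for t
  proof (cases "t \<in> U")
    case True
    then obtain \<delta> where \<delta>: "\<delta> > 0" "ball t \<delta> \<subseteq> U"
      using U(1) by (meson openE)
    have "h u \<le> h t" if u: "u \<in> {0..1}" "t < u" "u < t + \<delta>" for u
    proof -
      have "{t..u} \<subseteq> ball t \<delta>" using u by (auto simp: dist_real_def)
      then have "g t + (u - t) \<le> g u" using g_grow[of t u] \<delta>(2) u t by auto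
      from mult_left_mono[OF this L0] have "L * g t + L * (u - t) \<le> L * g u"
        by (simp add: algebra_simps)
      moreover have "d * t \<le> d * u" using u d(1) by simp
      ultimately show ?thesis using L[of t u] u t unfolding h_def by simp
    qed
    then show ?thesis using \<delta>(1) by blast
  next
    case False
    then obtain D where D: "D \<le> 0" "(f has_real_derivative D) (at t)"
      using N(1) U(2) t by auto
    then have "((\<lambda>u. (f u - f t) / (u - t)) \<longlongrightarrow> D) (at t)"
      by (simp add: has_field_derivative_iff)
    then obtain \<delta> where \<delta>: "\<delta> > 0"
      "\<And>u. u \<noteq> t \<Longrightarrow> dist u t < \<delta> \<Longrightarrow> dist ((f u - f t) / (u - t)) D < d"
      using d(1) unfolding tendsto_iff eventually_at by blast
    have "h u \<le> h t" if u: "u \<in> {0..1}" "t < u" "u < t + \<delta>" for u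
    proof -
      have "(f u - f t) / (u - t) \<le> d"
        using \<delta>(2)[of u] u D(1) by (auto simp: dist_real_def)
      then have "f u - f t \<le> d * (u - t)" using u(2) by (simp add: divide_le_eq)
      moreover have "L * g t \<le> L * g u" using u g_mono L0 by (simp add: mult_left_mono)
      ultimately show ?thesis unfolding h_def by (simp add: algebra_simps)
    qed
    then show ?thesis using \<delta>(1) by blast
  qed
  \<comment> \<open>A supremum argument makes the local statement global; at the supremum the
    one-sided bound \<open>h_lip\<close> carries the inequality over from the left.\<close>
  define S where "S = {t \<in> {0..b}. \<forall>u\<in>{0..t}. h u \<le> h 0}"
  define c where "c = Sup S"
  have S0: "0 \<in> S" using b by (simp add: S_def)
  have bdd: "bdd_above S" by (rule bdd_aboveI[of _ b]) (simp add: S_def)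
  have "0 \<le> c" unfolding c_def using S0 bdd by (rule cSup_upper)
  moreover have "c \<le> b" unfolding c_def using S0 by (intro cSup_least) (auto simp: S_def)
  ultimately have c: "0 \<le> c" "c \<le> b" .
  have below: "h u \<le> h 0" if u: "0 \<le> u" "u < c" for u
  proof -
    obtain t where "t \<in> S" "u < t" using less_cSupD[of S u] u S0 unfolding c_def by blast
    then show ?thesis using u by (auto simp: S_def)
  qed
  have hc: "h c \<le> h 0"
  proof (cases "c = 0")
    case False
    have "((\<lambda>u. h 0 + L * (c - u)) \<longlongrightarrow> h 0 + L * (c - c)) (at_left c)"
      by (intro tendsto_intros)
    moreover have "\<forall>\<^sub>F u in at_left c. h c \<le> h 0 + L * (c - u)"
    proof -
      have "h c \<le> h 0 + L * (c - u)" if "0 < u" "u < c" for u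
        using h_lip[of u c] below[of u] that c b by fastforce
      then show ?thesis using eventually_at_left_real[of 0 c] c False
        by (auto elim!: eventually_mono)
    qed
    ultimately have "h c \<le> h 0 + L * (c - c)"
      by (intro tendsto_lowerbound) auto
    then show ?thesis by simp
  qed simp
  have "c = b"
  proof (rule ccontr)
    assume "c \<noteq> b"
    then have "c < b" using c by simp
    obtain \<delta> where \<delta>: "\<delta> > 0" "\<forall>u\<in>{0..1}. c < u \<and> u < c + \<delta> \<longrightarrow> h u \<le> h c"
      using local[of c] c b by auto
    define t where "t = min b (c + \<delta> / 2)"
    have t: "c < t" "t \<le> b" "t < c + \<delta>" using \<open>c < b\<close> \<delta>(1) by (auto simp: t_def min_def)
    have "h u \<le> h 0" if "u \<in> {0..t}" for u
    proof (cases "c < u")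
      case True
      then show ?thesis using \<delta>(2) that t b hc by force
    next
      case False
      then show ?thesis using below[of u] hc that by (cases "u = c") auto
    qed
    then have "t \<in> S" using t c by (simp add: S_def)
    then have "t \<le> c" unfolding c_def using bdd by (rule cSup_upper)
    then show False using t by simp
  qed
  then have "h b \<le> h 0" using hc by simp
  moreover have "L * g b \<le> L * d" "d * b \<le> d" "0 \<le> L * g 0"
    using g_le L0 d(1) b g_nonneg by (auto simp: mult_left_mono)
  moreover have "L * d + d = e" using d(2) by (simp add: algebra_simps)
  ultimately show "f b \<le> f 0 + e" unfolding h_def by simp
qed

lemma lipschitz_on_mult_unit_interval:
  fixes f g :: "real \<Rightarrow> real"
  assumes "A-lipschitz_on {0..1} f" "B-lipschitz_on {0..1} g"
  shows "\<exists>C. C-lipschitz_on {0..1} (\<lambda>t. f t * g t)"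
proof -
  have bound: "\<bar>u t\<bar> \<le> \<bar>u 0\<bar> + M" if "M-lipschitz_on {0..1} u" "t \<in> {0..1}" for M t and u :: "real \<Rightarrow> real"
  proof -
    have "\<bar>u t - u 0\<bar> \<le> M * \<bar>t\<bar>"
      using lipschitz_onD[OF that, of 0] by (simp add: dist_real_def)
    also have "\<dots> \<le> M" using that lipschitz_on_nonneg[OF that(1)] by (simp add: mult_left_le)
    finally show ?thesis by linarith
  qed
  define C where "C = (\<bar>f 0\<bar> + A) * B + (\<bar>g 0\<bar> + B) * A"
  have AB: "0 \<le> A" "0 \<le> B" using assms lipschitz_on_nonneg by blast+
  have "C-lipschitz_on {0..1} (\<lambda>t. f t * g t)"
  proof (rule lipschitz_onI)
    fix s t :: real assume st: "s \<in> {0..1}" "t \<in> {0..1}"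
    have "\<bar>f s * g s - f t * g t\<bar> = \<bar>f s * (g s - g t) + g t * (f s - f t)\<bar>"
      by (simp add: algebra_simps)
    also have "\<dots> \<le> \<bar>f s\<bar> * \<bar>g s - g t\<bar> + \<bar>g t\<bar> * \<bar>f s - f t\<bar>"
      by (metis abs_mult abs_triangle_ineq)
    also have "\<dots> \<le> (\<bar>f 0\<bar> + A) * (B * \<bar>s - t\<bar>) + (\<bar>g 0\<bar> + B) * (A * \<bar>s - t\<bar>)"
      using lipschitz_onD[OF assms(1) st] lipschitz_onD[OF assms(2) st]
        bound[OF assms(1) st(1)] bound[OF assms(2) st(2)] AB
      by (intro add_mono mult_mono) (auto simp: dist_real_def)
    also have "\<dots> = C * \<bar>s - t\<bar>" by (simp add: C_def algebra_simps)
    finally show "dist (f s * g s) (f t * g t) \<le> C * dist s t" by (simp add: dist_real_def)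
  qed (use AB in \<open>simp add: C_def\<close>)
  then show ?thesis ..
qed

lemma lipcurve_lipschitz_on: "lipcurve n \<gamma> \<Longrightarrow> k \<in> {1..n} \<Longrightarrow> \<exists>L. L-lipschitz_on {0..1} (\<lambda>t. \<gamma> t k)"
proof -
  assume "lipcurve n \<gamma>" and k: "k \<in> {1..n}"
  then obtain L where L: "\<bar>\<gamma> s k - \<gamma> t k\<bar> \<le> L * \<bar>s - t\<bar>" if "s \<in> {0..1}" "t \<in> {0..1}" for s t
    unfolding lipcurve_def by blast
  have "\<bar>L\<bar>-lipschitz_on {0..1} (\<lambda>t. \<gamma> t k)"
  proof (rule lipschitz_onI)
    fix s t :: real assume "s \<in> {0..1}" "t \<in> {0..1}"
    from L[OF this] have "\<bar>\<gamma> s k - \<gamma> t k\<bar> \<le> \<bar>L\<bar> * \<bar>s - t\<bar>"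
      by (rule order_trans) (simp add: mult_right_mono)
    then show "dist (\<gamma> s k) (\<gamma> t k) \<le> \<bar>L\<bar> * dist s t" by (simp add: dist_real_def)
  qed simp
  then show ?thesis ..
qed

lemma polyfun_lipschitz_on:
  assumes "polyfun n f" "lipcurve n \<gamma>"
  shows "\<exists>L. L-lipschitz_on {0..1} (\<lambda>t. f (\<gamma> t))"
  using assms(1)
proof (induction rule: polyfun.induct)
  case (polyfun_const c)
  then show ?case using lipschitz_on_constant by blast
next
  case (polyfun_var j)
  then show ?case using lipcurve_lipschitz_on assms(2) by blast
next
  case (polyfun_add f g)
  then show ?case using lipschitz_on_add by blast
next
  case (polyfun_mult f g)
  then show ?case using lipschitz_on_mult_unit_interval by blast
qed

text \<open>Gronwall: the exponentially weighted square norm of the solution does not increase.\<close>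

lemma linear_ode_ae_unique:
  fixes u :: "real \<Rightarrow> nat \<Rightarrow> real" and a :: "real \<Rightarrow> nat \<Rightarrow> nat \<Rightarrow> real"
  assumes lip: "\<And>i. i \<in> I \<Longrightarrow> \<exists>L. L-lipschitz_on {0..1} (\<lambda>t. u t i)"
    and I: "finite I"
    and ode: "AE t in lborel. t \<in> {0..1} \<longrightarrow> (\<forall>i\<in>I.
      ((\<lambda>\<tau>. u \<tau> i) has_real_derivative (\<Sum>k\<in>I. a t i k * u t k)) (at t) \<and> (\<forall>k\<in>I. \<bar>a t i k\<bar> \<le> M))"
    and zero: "\<And>i. i \<in> I \<Longrightarrow> u 0 i = 0"
    and t: "t \<in> {0..1}" and i: "i \<in> I"
  shows "u t i = 0"
proof -
  \<comment> \<open>From \<open>2 * \<bar>u t i * u t k\<bar> \<le> u t i * u t i + u t k * u t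
    k\<close>: summing over all pairs counts each square \<open>2 * card I\<close> times. The sign
    of \<open>M\<close> is not assumed.\<close>
  define C where "C = 2 * \<bar>M\<bar> * card I"
  define \<phi> where "\<phi> t = (\<Sum>i\<in>I. u t i * u t i) * exp (- C * t)" for t
  have "\<exists>L. L-lipschitz_on {0..1} (\<lambda>t. \<Sum>i\<in>J. u t i * u t i)" if "J \<subseteq> I" for J
    using finite_subset[OF that I] that
  proof (induction J rule: finite_induct)
    case empty
    then show ?case using lipschitz_on_constant[of _ 0] by auto
  next
    case (insert i J)
    obtain L where "L-lipschitz_on {0..1} (\<lambda>t. u t i)" using lip insert.prems by blast
    from lipschitz_on_mult_unit_interval[OF this this]
    obtain A where "A-lipschitz_on {0..1} (\<lambda>t. u t i * u t i)" by blast
    moreover obtain B where "B-lipschitz_on {0..1} (\<lambda>t. \<Sum>i\<in>J. u t i * u t i)"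
      using insert by blast
    ultimately show ?case using insert.hyps lipschitz_on_add[of A _ "\<lambda>t. u t i * u t i" B] by auto
  qed
  then obtain A where A: "A-lipschitz_on {0..1} (\<lambda>t. \<Sum>i\<in>I. u t i * u t i)" by blast
  have "C \<ge> 0" by (simp add: C_def)
  have "C-lipschitz_on {0..1} (\<lambda>t. exp (- C * t))"
  proof (rule bounded_derivative_imp_lipschitz[where f' = "\<lambda>x. (*) (- C * exp (- C * x))"])
    fix x :: real assume x: "x \<in> {0..1}"
    have "((\<lambda>t. exp (- C * t)) has_real_derivative - C * exp (- C * x)) (at x within {0..1})"
      by (auto intro!: derivative_eq_intros)
    then show "((\<lambda>t. exp (- C * t)) has_derivative (*) (- C * exp (- C * x))) (at x within {0..1})"
      unfolding has_field_derivative_def .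
    have "C * exp (- C * x) \<le> C" using x \<open>C \<ge> 0\<close> by (simp add: mult_left_le)
    then show "onorm ((*) (- C * exp (- C * x))) \<le> C"
      using \<open>C \<ge> 0\<close> by (intro onorm_le) (simp add: abs_mult mult_right_mono)
  qed (use \<open>C \<ge> 0\<close> in auto)
  then obtain B where B: "B-lipschitz_on {0..1} \<phi>"
    using lipschitz_on_mult_unit_interval[OF A] unfolding \<phi>_def by blast
  have "AE t in lborel. t \<in> {0..1} \<longrightarrow> (\<exists>D\<le>0. (\<phi> has_real_derivative D) (at t))"
    using ode
  proof (eventually_elim, intro impI)
    fix t :: real
    assume "t \<in> {0..1} \<longrightarrow> (\<forall>i\<in>I.
      ((\<lambda>\<tau>. u \<tau> i) has_real_derivative (\<Sum>k\<in>I. a t i k * u t k)) (at t) \<and> (\<forall>k\<in>I. \<bar>a t i k\<bar> \<le> M))"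
      and "t \<in> {0..1}"
    then have der: "\<And>i. i \<in> I \<Longrightarrow> ((\<lambda>\<tau>. u \<tau> i) has_real_derivative (\<Sum>k\<in>I. a t i k * u t k)) (at t)"
      and M: "\<And>i k. i \<in> I \<Longrightarrow> k \<in> I \<Longrightarrow> \<bar>a t i k\<bar> \<le> M" by auto
    define Q where "Q = (\<Sum>i\<in>I. u t i * u t i)"
    define R where "R = (\<Sum>i\<in>I. 2 * u t i * (\<Sum>k\<in>I. a t i k * u t k))"
    have "((\<lambda>\<tau>. \<Sum>i\<in>I. u \<tau> i * u \<tau> i) has_real_derivative R) (at t)"
      unfolding R_def
    proof (rule DERIV_sum)
      fix i assume "i \<in> I"
      from DERIV_mult[OF der[OF this] der[OF this]]
      show "((\<lambda>\<tau>. u \<tau> i * u \<tau> i) has_real_derivative 2 * u t i * (\<Sum>k\<in>I. a t i k * u t k)) (at t)"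
        by (simp add: algebra_simps)
    qed
    moreover have "((\<lambda>t. exp (- C * t)) has_real_derivative - C * exp (- C * t)) (at t)"
      by (auto intro!: derivative_eq_intros)
    ultimately have "(\<phi> has_real_derivative R * exp (- C * t) + - C * exp (- C * t) * Q) (at t)"
      unfolding \<phi>_def Q_def by (rule DERIV_mult)
    moreover have "R \<le> C * Q"
    proof -
      have "R = (\<Sum>i\<in>I. \<Sum>k\<in>I. 2 * (a t i k * (u t i * u t k)))"
        unfolding R_def by (simp add: sum_distrib_left algebra_simps)
      also have "\<dots> \<le> (\<Sum>i\<in>I. \<Sum>k\<in>I. \<bar>M\<bar> * (u t i * u t i + u t k * u t k))"
      proof (intro sum_mono)
        fix i k assume ik: "i \<in> I" "k \<in> I"
        have "2 * \<bar>u t i * u t k\<bar> \<le> u t i * u t i + u t k * u t k"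
          using sum_squares_bound[of "\<bar>u t i\<bar>" "\<bar>u t k\<bar>"] by (simp add: power2_eq_square abs_mult)
        moreover have "a t i k * (u t i * u t k) \<le> \<bar>M\<bar> * \<bar>u t i * u t k\<bar>"
        proof -
          have "a t i k * (u t i * u t k) \<le> \<bar>a t i k\<bar> * \<bar>u t i * u t k\<bar>"
            by (metis abs_ge_self abs_mult)
          also have "\<dots> \<le> \<bar>M\<bar> * \<bar>u t i * u t k\<bar>"
            using M[OF ik] by (intro mult_right_mono) auto
          finally show ?thesis .
        qed
        ultimately show "2 * (a t i k * (u t i * u t k)) \<le> \<bar>M\<bar> * (u t i * u t i + u t k * u t k)"
          using mult_left_mono[of "2 * \<bar>u t i * u t k\<bar>" "u t i * u t i + u t k * u t k" "\<bar>M\<bar>"] by linarith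
      qed
      also have "\<dots> = C * Q"
        by (simp add: sum.distrib flip: sum_distrib_left) (simp add: Q_def C_def)
      finally show ?thesis .
    qed
    then have "R * exp (- C * t) + - C * exp (- C * t) * Q \<le> 0"
      using mult_right_mono[of R "C * Q" "exp (- C * t)"] by (simp add: algebra_simps)
    ultimately show "\<exists>D\<le>0. (\<phi> has_real_derivative D) (at t)" by blast
  qed
  from lipschitz_ae_nonpos_derivative_imp_le[OF B this t]
  have "\<phi> t \<le> 0" using zero by (simp add: \<phi>_def)
  then have "(\<Sum>i\<in>I. u t i * u t i) \<le> 0"
    by (simp add: \<phi>_def mult_le_0_iff)
  then have "(\<Sum>i\<in>I. u t i * u t i) = 0"
    by (intro antisym sum_nonneg) auto
  then show ?thesis using sum_nonneg_eq_0_iff[of I "\<lambda>i. u t i * u t i"] I i by simp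
qed

section \<open>The adjoint equation along horizontal curves\<close>

theorem theorem4p6:
  fixes r s n :: nat and K :: "nat \<Rightarrow> nat \<times> nat" and dg :: "nat \<Rightarrow> nat"
    and \<gamma> lam :: "real \<Rightarrow> nat \<Rightarrow> real"
  assumes "r \<ge> 2" and "s \<ge> 2" and "hall_basis r s n K dg"
    and "horizontal r n K \<gamma>" and "\<forall>k\<in>{1..n}. \<gamma> 0 k = 0"
    and "lipcurve n lam"
  shows "((\<forall>i\<in>{1..n}. AE t in lborel. t \<in> {0..1} \<longrightarrow>
            ((\<lambda>\<tau>. lam \<tau> i) has_real_derivative
               - (\<Sum>k=1..n. \<Sum>j=1..r. sc r n K i j k * deriv (\<lambda>\<tau>. \<gamma> \<tau> j) t * lam t k)) (at t))
          \<longleftrightarrow> (\<exists>v. \<forall>t\<in>{0..1}. \<forall>i\<in>{1..n}. lam t i = Pext r n K v i (\<gamma> t)))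
        \<and> (\<forall>v. (\<forall>t\<in>{0..1}. \<forall>i\<in>{1..n}. lam t i = Pext r n K v i (\<gamma> t))
               \<longrightarrow> (\<forall>k\<in>{1..n}. v k = lam 0 k))"
    (is "(?A \<longleftrightarrow> (\<exists>v. ?B v)) \<and> ?C")
proof -
  interpret hall r s n K dg
    using assms(1,3) by unfold_locales
  have lip: "lipcurve n \<gamma>" using assms(4) by (simp add: horizontal_def)
  obtain h :: "nat \<Rightarrow> real \<Rightarrow> real" where
    h_bound: "\<And>j. j \<in> {1..r} \<Longrightarrow> \<exists>B. AE t in lborel. t \<in> {0..1} \<longrightarrow> \<bar>h j t\<bar> \<le> B"
    and \<gamma>_deriv: "AE t in lborel. t \<in> {0..1} \<longrightarrow> (\<forall>l\<in>{1..n}.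
        ((\<lambda>\<tau>. \<gamma> \<tau> l) has_real_derivative (\<Sum>j=1..r. h j t * X j (\<gamma> t) l)) (at t))"
    using assms(4) unfolding horizontal_def by blast
  have P0: "Pext r n K v i (\<gamma> 0) = v i" if "i \<in> {1..n}" for v i
    using polyfun_cong_coords[OF polyfun_Pext[OF that], of "\<gamma> 0" "\<lambda>_. 0" v] assms(5) Pext_at_0[OF that] by simp
  \<comment> \<open>A string of length one has no other generator as initial segment, so the first
    \<open>r\<close> components of the generators form the identity matrix and the controls are the
    derivatives of the first \<open>r\<close> coordinates.\<close>
  have deriv_eq: "deriv (\<lambda>\<tau>. \<gamma> \<tau> j) t = h j t"
    if "\<forall>l\<in>{1..n}. ((\<lambda>\<tau>. \<gamma> \<tau> l) has_real_derivative (\<Sum>j=1..r. h j t * X j (\<gamma> t) l)) (at t)"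
      "j \<in> {1..r}" for t j
  proof -
    have "X i (\<gamma> t) j = (if i = j then 1 else 0)" if "i \<in> {1..r}" for i
      using that \<open>j \<in> {1..r}\<close> rank_le_dim
      by (auto simp: X_generator_E E_def str_generator)
    then have "(\<Sum>i=1..r. h i t * X i (\<gamma> t) j) = (\<Sum>i=1..r. if i = j then h i t else 0)"
      by (intro sum.cong) auto
    also have "\<dots> = h j t" using that(2) by simp
    finally show ?thesis
      using that(1) that(2) rank_le_dim DERIV_imp_deriv[of "\<lambda>\<tau>. \<gamma> \<tau> j"] by force
  qed
  have P_deriv: "((\<lambda>\<tau>. Pext r n K v i (\<gamma> \<tau>)) has_real_derivative
      - (\<Sum>k=1..n. \<Sum>j=1..r. sc r n K i j k * deriv (\<lambda>\<tau>. \<gamma> \<tau> j) t * Pext r n K v k (\<gamma> t))) (at t)"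
    if \<gamma>: "\<forall>l\<in>{1..n}. ((\<lambda>\<tau>. \<gamma> \<tau> l) has_real_derivative (\<Sum>j=1..r. h j t * X j (\<gamma> t) l)) (at t)"
      and i: "i \<in> {1..n}" for t i v
  proof -
    let ?P = "Pext r n K v"
    have "(\<Sum>l=1..n. (\<Sum>j=1..r. h j t * X j (\<gamma> t) l) * pd (?P i) l (\<gamma> t))
        = (\<Sum>j=1..r. h j t * lie_deriv n (X j) (?P i) (\<gamma> t))"
      unfolding lie_deriv_def sum_distrib_left sum_distrib_right
      by (subst sum.swap) (simp add: mult.assoc)
    also have "\<dots> = (\<Sum>j=1..r. \<Sum>k=1..n. - (sc r n K i j k * h j t * ?P k (\<gamma> t)))"
      by (intro sum.cong) (simp_all add: lie_deriv_Pext[OF i] sum_distrib_left sum_negf algebra_simps)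
    also have "\<dots> = - (\<Sum>k=1..n. \<Sum>j=1..r. sc r n K i j k * deriv (\<lambda>\<tau>. \<gamma> \<tau> j) t * ?P k (\<gamma> t))"
      by (subst sum.swap) (simp add: sum_negf deriv_eq[OF \<gamma>])
    finally show ?thesis
      using polyfun_chain_rule[OF polyfun_Pext[OF i, of v], of \<gamma> "\<lambda>l. \<Sum>j=1..r. h j t * X j (\<gamma> t) l" t] \<gamma>
      by simp
  qed
  have C: "v k = lam 0 k" if "?B v" "k \<in> {1..n}" for v k
    using that P0[of k v] by simp
  have "?B v \<Longrightarrow> ?A" for v
  proof
    fix i assume B: "?B v" and i: "i \<in> {1..n}"
    \<comment> \<open>The representation of \<open>lam\<close> is given on \<open>{0..1}\<close>
      only, whereas the derivative is two-sided; the endpoints are discarded as a null set.\<close>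
    have "AE t in lborel. t \<noteq> 0 \<and> t \<noteq> (1::real)"
      using AE_lborel_singleton[of "0::real"] AE_lborel_singleton[of "1::real"] by eventually_elim simp
    then show "AE t in lborel. t \<in> {0..1} \<longrightarrow> ((\<lambda>\<tau>. lam \<tau> i) has_real_derivative
               - (\<Sum>k=1..n. \<Sum>j=1..r. sc r n K i j k * deriv (\<lambda>\<tau>. \<gamma> \<tau> j) t * lam t k)) (at t)"
      using \<gamma>_deriv
    proof (eventually_elim, intro impI)
      fix t :: real
      assume "t \<noteq> 0 \<and> t \<noteq> 1" and t: "t \<in> {0..1}" and "t \<in> {0..1} \<longrightarrow> (\<forall>l\<in>{1..n}.
        ((\<lambda>\<tau>. \<gamma> \<tau> l) has_real_derivative (\<Sum>j=1..r. h j t * X j (\<gamma> t) l)) (at t))"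
      then have \<gamma>: "\<forall>l\<in>{1..n}. ((\<lambda>\<tau>. \<gamma> \<tau> l) has_real_derivative (\<Sum>j=1..r. h j t * X j (\<gamma> t) l)) (at t)"
        and t': "t \<in> {0<..<1}" by auto
      have "((\<lambda>\<tau>. lam \<tau> i) has_real_derivative
          - (\<Sum>k=1..n. \<Sum>j=1..r. sc r n K i j k * deriv (\<lambda>\<tau>. \<gamma> \<tau> j) t * Pext r n K v k (\<gamma> t))) (at t)"
        by (rule has_field_derivative_transform_within_open[OF P_deriv[OF \<gamma> i, of v] _ t'])
          (use B i in auto)
      then show "((\<lambda>\<tau>. lam \<tau> i) has_real_derivative
          - (\<Sum>k=1..n. \<Sum>j=1..r. sc r n K i j k * deriv (\<lambda>\<tau>. \<gamma> \<tau> j) t * lam t k)) (at t)"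
        using B t by simp
    qed
  qed
  moreover have "?B (lam 0)" if A: ?A
  proof (intro ballI)
    fix t :: real and i assume t: "t \<in> {0..1}" and i: "i \<in> {1..n}"
    define v where "v = lam 0"
    define a where "a t i k = - (\<Sum>j=1..r. sc r n K i j k * deriv (\<lambda>\<tau>. \<gamma> \<tau> j) t)" for t i k
    \<comment> \<open>Both \<open>lam\<close> and the extremal polynomials along the curve solve the
      same linear equation with the same initial value, so their difference is a solution starting
      at zero.\<close>
    define u where "u t i = lam t i - Pext r n K v i (\<gamma> t)" for t i
    obtain B where B: "\<And>j. j \<in> {1..r} \<Longrightarrow> AE t in lborel. t \<in> {0..1} \<longrightarrow> \<bar>h j t\<bar> \<le> B j"
      using h_bound by metis
    have Ball: "AE t in lborel. \<forall>j\<in>{1..r}. t \<in> {0..1} \<longrightarrow> \<bar>h j t\<bar> \<le> B j"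
      using B by (intro AE_finite_allI) auto
    \<comment> \<open>The equation has essentially bounded coefficients because the controls are
      essentially bounded. \<open>M\<close> is a crude common bound, with absolute values since
      nothing is recorded about the sign of \<open>B j\<close>.\<close>
    define m where "m i k = (\<Sum>j=1..r. \<bar>sc r n K i j k\<bar> * B j)" for i k
    define M where "M = (\<Sum>i=1..n. \<Sum>k=1..n. \<bar>m i k\<bar>)"
    have mM: "m i k \<le> M" if "i \<in> {1..n}" "k \<in> {1..n}" for i k
    proof -
      have "m i k \<le> \<bar>m i k\<bar>" by simp
      also have "\<dots> \<le> (\<Sum>k=1..n. \<bar>m i k\<bar>)"
        using that by (intro member_le_sum) auto
      also have "\<dots> \<le> M"
        unfolding M_def using that by (intro member_le_sum[of i _ "\<lambda>i. \<Sum>k=1..n. \<bar>m i k\<bar>"]) (auto intro: sum_nonneg)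
      finally show ?thesis .
    qed
    have "AE t in lborel. \<forall>i\<in>{1..n}. t \<in> {0..1} \<longrightarrow> ((\<lambda>\<tau>. lam \<tau> i) has_real_derivative
               - (\<Sum>k=1..n. \<Sum>j=1..r. sc r n K i j k * deriv (\<lambda>\<tau>. \<gamma> \<tau> j) t * lam t k)) (at t)"
      using A by (intro AE_finite_allI) auto
    with \<gamma>_deriv Ball have ode: "AE t in lborel. t \<in> {0..1} \<longrightarrow> (\<forall>i\<in>{1..n}.
      ((\<lambda>\<tau>. u \<tau> i) has_real_derivative (\<Sum>k\<in>{1..n}. a t i k * u t k)) (at t) \<and> (\<forall>k\<in>{1..n}. \<bar>a t i k\<bar> \<le> M))"
    proof (eventually_elim, intro impI ballI conjI)
      fix t :: real and i
      assume t: "t \<in> {0..1}" and i: "i \<in> {1..n}"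
        and "t \<in> {0..1} \<longrightarrow> (\<forall>l\<in>{1..n}.
          ((\<lambda>\<tau>. \<gamma> \<tau> l) has_real_derivative (\<Sum>j=1..r. h j t * X j (\<gamma> t) l)) (at t))"
        and hB: "\<forall>j\<in>{1..r}. t \<in> {0..1} \<longrightarrow> \<bar>h j t\<bar> \<le> B j"
        and lam: "\<forall>i\<in>{1..n}. t \<in> {0..1} \<longrightarrow> ((\<lambda>\<tau>. lam \<tau> i) has_real_derivative
               - (\<Sum>k=1..n. \<Sum>j=1..r. sc r n K i j k * deriv (\<lambda>\<tau>. \<gamma> \<tau> j) t * lam t k)) (at t)"
      then have \<gamma>: "\<forall>l\<in>{1..n}. ((\<lambda>\<tau>. \<gamma> \<tau> l) has_real_derivative (\<Sum>j=1..r. h j t * X j (\<gamma> t) l)) (at t)"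
        by blast
      have "(- (\<Sum>k=1..n. \<Sum>j=1..r. sc r n K i j k * deriv (\<lambda>\<tau>. \<gamma> \<tau> j) t * lam t k))
        - (- (\<Sum>k=1..n. \<Sum>j=1..r. sc r n K i j k * deriv (\<lambda>\<tau>. \<gamma> \<tau> j) t * Pext r n K v k (\<gamma> t)))
        = (\<Sum>k\<in>{1..n}. a t i k * u t k)"
        unfolding a_def u_def
        by (simp add: sum_negf sum_subtractf right_diff_distrib sum_distrib_right)
      then show "((\<lambda>\<tau>. u \<tau> i) has_real_derivative (\<Sum>k\<in>{1..n}. a t i k * u t k)) (at t)"
        using DERIV_diff[OF lam[rule_format, OF i t] P_deriv[OF \<gamma> i, of v]] by (simp only: u_def)
      fix k assume k: "k \<in> {1..n}"
      have "\<bar>a t i k\<bar> \<le> (\<Sum>j=1..r. \<bar>sc r n K i j k * deriv (\<lambda>\<tau>. \<gamma> \<tau> j) t\<bar>)"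
        unfolding a_def abs_minus_cancel by (rule sum_abs)
      also have "\<dots> \<le> m i k"
        unfolding m_def using hB t
        by (intro sum_mono) (simp add: abs_mult deriv_eq[OF \<gamma>] mult_left_mono)
      also have "\<dots> \<le> M" using mM i k by blast
      finally show "\<bar>a t i k\<bar> \<le> M" .
    qed
    have u_lip: "\<exists>L. L-lipschitz_on {0..1} (\<lambda>t. u t i)" if "i \<in> {1..n}" for i
      using lipcurve_lipschitz_on[OF assms(6) that] polyfun_lipschitz_on[OF polyfun_Pext[OF that, of v] lip]
        lipschitz_on_diff[of _ _ "\<lambda>t. lam t i" _ "\<lambda>t. Pext r n K v i (\<gamma> t)"]
      unfolding u_def by blast
    have "u t i = 0"
      by (rule linear_ode_ae_unique[OF u_lip _ ode _ t i]) (simp_all add: u_def P0 v_def)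
    then show "lam t i = Pext r n K (lam 0) i (\<gamma> t)" by (simp add: u_def v_def)
  qed
  ultimately show ?thesis using C by blast
qed

end
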